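(* There exists a deterministic algorithm that, given an undirected graph $G=(V,E)$ with minimum degree at least $3$ and a number $0<\varepsilon<1$, outputs an $\varepsilon$-approximation to the number of sink-free orientations of $G$, with running time $O\big((n^{73}/\varepsilon^{72})\log(n/\varepsilon)\big)$, where $n=|V|$ is the number of vertices of $G$.
   Context: Graphs are finite, undirected and not necessarily simple (parallel edges are allowed; each edge joins two distinct vertices). The input graph is given as an adjacency list in which the neighbours of each vertex are arbitrarily ordered. An orientation of $G$ assigns a direction to each edge. A vertex is a sink in an orientation if it has no outgoing edge. An orientation of $G$ is sink-free if every vertex has at least one outgoing edge. For a target quantity $Z>0$, an $\varepsilon$-approximation to $Z$ is a number $\widetilde Z$ with $1-\varepsilon\le \widetilde Z/Z\le 1+\varepsilon$. *)

theory Defs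
  imports Complex_Main "HOL-Library.FuncSet"
begin

section \<open>Multigraphs and sink-free orientations\<close>

record ('v, 'e) multigraph =
  verts :: "'v set"
  edges :: "'e set"
  ends  :: "'e \<Rightarrow> 'v set"

text \<open>Parallel edges are different edges with the same set of ends; there are no loops.\<close>

definition wf_multigraph :: "('v, 'e) multigraph \<Rightarrow> bool" where
  "wf_multigraph G \<longleftrightarrow> finite (verts G) \<and> finite (edges G) \<and>
     (\<forall>e\<in>edges G. ends G e \<subseteq> verts G \<and> card (ends G e) = 2)"

definition vdegree :: "('v, 'e) multigraph \<Rightarrow> 'v \<Rightarrow> nat" where
  "vdegree G v = card {e \<in> edges G. v \<in> ends G e}"

text \<open>Meaningful only for graphs with at least one vertex.\<close>

definition min_degree :: "('v, 'e) multigraph \<Rightarrow> nat" where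
  "min_degree G = Min (vdegree G ` verts G)"

text \<open>The pair \<open>(u, v)\<close> stands for the direction from \<open>u\<close> to \<open>v\<close>.\<close>

definition orientations :: "('v, 'e) multigraph \<Rightarrow> ('e \<Rightarrow> 'v \<times> 'v) set" where
  "orientations G = (\<Pi>\<^sub>E e\<in>edges G. {(u, v). ends G e = {u, v}})"

definition is_sink :: "('v, 'e) multigraph \<Rightarrow> ('e \<Rightarrow> 'v \<times> 'v) \<Rightarrow> 'v \<Rightarrow> bool" where
  "is_sink G d v \<longleftrightarrow> \<not> (\<exists>e\<in>edges G. fst (d e) = v)"

definition sink_free_orientations :: "('v, 'e) multigraph \<Rightarrow> ('e \<Rightarrow> 'v \<times> 'v) set" where
  "sink_free_orientations G = {d \<in> orientations G. \<forall>v\<in>verts G. \<not> is_sink G d v}"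

definition is_approximation :: "real \<Rightarrow> real \<Rightarrow> real \<Rightarrow> bool" where
  "is_approximation \<epsilon> Z Z' \<longleftrightarrow> Z > 0 \<and> 1 - \<epsilon> \<le> Z' / Z \<and> Z' / Z \<le> 1 + \<epsilon>"


section \<open>Random access machines\<close>

text \<open>
  A unit-cost RAM over natural numbers, with directly addressed registers and an indirectly
  addressed memory. The operations are exact; that the machine is a word RAM is expressed by
  requiring that no register or memory cell ever exceeds a bound (see \<open>fits\<close>), so that
  no power is gained from unit-cost arithmetic on long numbers.

  The accuracy \<open>\<epsilon>\<close> is an arbitrary real number. A program accesses it only by comparing
  it with a quotient of two register contents: \<open>JumpEps i j l\<close> jumps to \<open>l\<close> if
  \<open>x < \<epsilon> * y\<close> for the contents \<open>x, y\<close> of the registers \<open>i, j\<close>. If \<open>\<epsilon> = p / q\<close> is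
  given by two words \<open>p, q\<close>, then this test takes a constant number of ordinary instructions.
\<close>

datatype instr =
    Const nat nat
  | Add nat nat nat
  | Sub nat nat nat
  | Mul nat nat nat
  | Div nat nat nat
  | Load nat nat
  | Store nat nat
  | Jump nat
  | JumpLess nat nat nat
  | JumpEps nat nat nat

record config =
  pc   :: nat
  regs :: "nat \<Rightarrow> nat"
  mem  :: "nat \<Rightarrow> nat"

definition set_reg :: "nat \<Rightarrow> nat \<Rightarrow> config \<Rightarrow> config" where
  "set_reg i x s = s\<lparr>regs := (regs s)(i := x), pc := Suc (pc s)\<rparr>"

definition branch :: "bool \<Rightarrow> nat \<Rightarrow> config \<Rightarrow> config" where
  "branch b l s = s\<lparr>pc := (if b then l else Suc (pc s))\<rparr>"

fun exec :: "real \<Rightarrow> instr \<Rightarrow> config \<Rightarrow> config" where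
  "exec \<epsilon> (Const i k) s = set_reg i k s"
| "exec \<epsilon> (Add i j k) s = set_reg i (regs s j + regs s k) s"
| "exec \<epsilon> (Sub i j k) s = set_reg i (regs s j - regs s k) s"
| "exec \<epsilon> (Mul i j k) s = set_reg i (regs s j * regs s k) s"
| "exec \<epsilon> (Div i j k) s = set_reg i (regs s j div regs s k) s"
| "exec \<epsilon> (Load i j) s = set_reg i (mem s (regs s j)) s"
| "exec \<epsilon> (Store i j) s = s\<lparr>mem := (mem s)(regs s i := regs s j), pc := Suc (pc s)\<rparr>"
| "exec \<epsilon> (Jump l) s = branch True l s"
| "exec \<epsilon> (JumpLess i j l) s = branch (regs s i < regs s j) l s"
| "exec \<epsilon> (JumpEps i j l) s = branch (real (regs s i) < \<epsilon> * real (regs s j)) l s"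

definition halted :: "instr list \<Rightarrow> config \<Rightarrow> bool" where
  "halted P s \<longleftrightarrow> length P \<le> pc s"

definition step :: "instr list \<Rightarrow> real \<Rightarrow> config \<Rightarrow> config" where
  "step P \<epsilon> s = (if halted P s then s else exec \<epsilon> (P ! pc s) s)"

definition run :: "instr list \<Rightarrow> real \<Rightarrow> nat \<Rightarrow> config \<Rightarrow> config" where
  "run P \<epsilon> t = step P \<epsilon> ^^ t"

definition fits :: "nat \<Rightarrow> config \<Rightarrow> bool" where
  "fits B s \<longleftrightarrow> (\<forall>i. regs s i \<le> B) \<and> (\<forall>a. mem s a \<le> B)"

definition initial_config :: "nat list \<Rightarrow> config" where
  "initial_config xs =
     \<lparr>pc = 0, regs = (\<lambda>_. 0), mem = (\<lambda>a. if a < length xs then xs ! a else 0)\<rparr>"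

text \<open>
  The result is a floating-point number: a mantissa in register 0 and an exponent that is the
  difference of registers 1 and 2. (With parallel edges the number of binary digits of the
  number of sink-free orientations is not bounded in terms of the number of vertices.)
\<close>

definition result :: "config \<Rightarrow> real" where
  "result s = real (regs s 0) * 2 ^ regs s 1 / 2 ^ regs s 2"


section \<open>Adjacency lists as input\<close>

definition numbered :: "(nat, nat) multigraph \<Rightarrow> bool" where
  "numbered G \<longleftrightarrow> verts G = {..<card (verts G)} \<and> edges G = {..<card (edges G)}"

text \<open>
  An entry of the list of \<open>v\<close> is a neighbour of \<open>v\<close> together with the number of the edge
  leading to it, which tells parallel edges apart. The order is arbitrary.
\<close>

definition adjacency_list :: "(nat, nat) multigraph \<Rightarrow> (nat \<Rightarrow> (nat \<times> nat) list) \<Rightarrow> bool" where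
  "adjacency_list G A \<longleftrightarrow> (\<forall>v\<in>verts G. distinct (A v) \<and>
     set (A v) = {(u, e). e \<in> edges G \<and> ends G e = {v, u}})"

text \<open>
  Memory layout: the number \<open>n\<close> of vertices; then for each vertex the length and the start
  address of its list; then the entries of all lists, two cells each.
\<close>

definition start_address :: "nat \<Rightarrow> (nat \<Rightarrow> (nat \<times> nat) list) \<Rightarrow> nat \<Rightarrow> nat" where
  "start_address n A v = 1 + 2 * n + 2 * (\<Sum>u<v. length (A u))"

definition encode :: "nat \<Rightarrow> (nat \<Rightarrow> (nat \<times> nat) list) \<Rightarrow> nat list" where
  "encode n A = n
     # concat (map (\<lambda>v. [length (A v), start_address n A v]) [0..<n])
     @ concat (map (\<lambda>v. concat (map (\<lambda>(u, e). [u, e]) (A v))) [0..<n])"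

text \<open>
  Cells may hold numbers polynomially large in the numbers of vertices and edges and in
  \<open>1 / \<epsilon>\<close>, i.e. words have \<open>c * log 2 (n + m + 1 / \<epsilon>)\<close> bits up to rounding, for a constant
  \<open>c\<close> depending only on the program.
\<close>

definition word_bound :: "nat \<Rightarrow> (nat, nat) multigraph \<Rightarrow> real \<Rightarrow> nat" where
  "word_bound c G \<epsilon> = (card (verts G) + card (edges G) + nat \<lceil>1 / \<epsilon>\<rceil>) ^ c"

end

theory Submission
  imports Defs
begin

text \<open>
  Sink events at adjacent vertices are disjoint and at distant vertices independent, which gives the
  exact recursion \<open>c (U \<union> {v}) = c U - c (U - N v) / 2 ^ d v\<close> for the number \<open>c U\<close> of orientations
  without a sink in \<open>U\<close>. The ratios \<open>c (U \<union> {v}) / c U\<close> telescope to the wanted number divided by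
  \<open>2 ^ m\<close>. Telescoping \<open>c (U - N v) / c U\<close> over the neighbours of \<open>v\<close> in the same way expresses each
  ratio by ratios for smaller sets. As all degrees are at least 3, these ratios are at least 4/5 below
  the root and a step of the recursion at a vertex of degree \<open>d\<close> contracts errors by the factor
  \<open>(39/40) ^ d\<close>. Cutting the recursion off when the sum of the degrees along a branch exceeds
  \<open>b = 28 log 2 (n / \<epsilon>) + O(1)\<close> makes all relative errors at most \<open>\<epsilon> / (2 n)\<close>, and the recursion tree
  has size \<open>O(2 ^ b)\<close>, which is \<open>O((n / \<epsilon>) ^ 28)\<close>.
\<close>

section \<open>Counting orientations with prescribed non-sinks\<close>

text \<open>A cut-off by depth would not do: a vertex may have up to \<open>n - 1\<close> distinct
  neighbours, so logarithmic depth would allow a tree of superpolynomial size, and with parallel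
  edges the lists themselves are unbounded in \<open>n\<close>. Charging every vertex its degree
  balances both effects: a vertex of degree \<open>d\<close> has at most \<open>d\<close> children,
  but it contracts errors exponentially in \<open>d\<close>, and \<open>d\<close> calls with budget
  \<open>b - d\<close> are affordable because \<open>2 * d + 2 \<le> 2 ^ d\<close>. The bound 4/5
  for children cannot be relaxed to the bound 3/4 that holds at a root: errors are multiplied by
  \<open>3 * (5/4) * (5/8) ^ 3 < 1\<close> at degree 3, whereas 3/4 would give
  \<open>3 * (4/3) * (2/3) ^ 3 = 32/27\<close>. Children have the better bound because their parent
  is already removed. The factor 28 in the budget comes from \<open>(39/40) ^ 28 \<le> 1/2\<close>.
  As \<open>n / \<epsilon> \<ge> 2\<close>, the exponent 28 may be raised to 72, and the logarithm
  in the claimed running time is bounded below by a constant.\<close>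

definition nonsinks :: "('v, 'e) multigraph \<Rightarrow> 'v set \<Rightarrow> ('e \<Rightarrow> 'v \<times> 'v) set" where
  "nonsinks G U = {d \<in> orientations G. \<forall>u\<in>U. \<not> is_sink G d u}"

definition neighbours :: "('v, 'e) multigraph \<Rightarrow> 'v \<Rightarrow> 'v set" where
  "neighbours G v = {u. \<exists>e\<in>edges G. ends G e = {v, u}}"

lemma card_directions:
  assumes "card X = 2"
  shows "card {(u, v). X = {u, v}} = 2"
proof -
  obtain a b where "X = {a, b}" "a \<noteq> b"
    using assms by (auto simp: card_2_iff)
  then have "{(u, v). X = {u, v}} = {(a, b), (b, a)}"
    by (auto simp: doubleton_eq_iff)
  with \<open>a \<noteq> b\<close> show ?thesis by simp
qed

lemma card_PiE_directions:
  assumes "wf_multigraph G" "E \<subseteq> edges G"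
  shows "card (\<Pi>\<^sub>E e\<in>E. {(u, v). ends G e = {u, v}}) = 2 ^ card E"
proof -
  have "finite E" using assms by (auto simp: wf_multigraph_def intro: finite_subset)
  then have "card (\<Pi>\<^sub>E e\<in>E. {(u, v). ends G e = {u, v}}) = (\<Prod>e\<in>E. card {(u, v). ends G e = {u, v}})"
    by (rule card_PiE)
  also have "\<dots> = (\<Prod>e\<in>E. 2)"
    using assms by (intro prod.cong refl card_directions) (auto simp: wf_multigraph_def)
  finally show ?thesis by simp
qed

lemma card_orientations:
  "wf_multigraph G \<Longrightarrow> card (orientations G) = 2 ^ card (edges G)"
  unfolding orientations_def by (rule card_PiE_directions) auto

lemma finite_orientations: "wf_multigraph G \<Longrightarrow> finite (orientations G)"
  using card_orientations[of G] by (metis card.infinite power_not_zero zero_neq_numeral)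

lemma finite_nonsinks: "wf_multigraph G \<Longrightarrow> finite (nonsinks G U)"
  by (auto simp: nonsinks_def intro: finite_subset[OF _ finite_orientations])

lemma ends_orientation:
  "d \<in> orientations G \<Longrightarrow> e \<in> edges G \<Longrightarrow> ends G e = {fst (d e), snd (d e)}"
  by (cases "d e") (auto simp: orientations_def PiE_def Pi_def)

lemma not_loop:
  assumes "wf_multigraph G" "d \<in> orientations G" "e \<in> edges G"
  shows "fst (d e) \<noteq> snd (d e)"
proof
  assume "fst (d e) = snd (d e)"
  then have "ends G e = {fst (d e)}" using ends_orientation[OF assms(2,3)] by simp
  moreover have "card (ends G e) = 2" using assms by (auto simp: wf_multigraph_def)
  ultimately show False by simp
qed

text \<open>Once \<open>v\<close> is a sink its neighbours cannot be sinks, and the edges at \<open>v\<close> have no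
  influence on the remaining vertices; hence the edges at \<open>v\<close> may be redirected freely.\<close>

lemma card_sink_nonsinks:
  assumes wf: "wf_multigraph G" and v: "v \<notin> U"
  shows "card {d \<in> nonsinks G U. is_sink G d v} * 2 ^ vdegree G v
    = card (nonsinks G (U - neighbours G v))"
proof -
  let ?E = "{e \<in> edges G. v \<in> ends G e}"
  let ?D = "\<lambda>e. {(a, b). ends G e = {a, b}}"
  let ?A = "{d \<in> nonsinks G U. is_sink G d v}"
  let ?B = "\<Pi>\<^sub>E e\<in>?E. ?D e"
  let ?C = "nonsinks G (U - neighbours G v)"
  \<comment> \<open>\<open>?h\<close> replaces the directions at \<open>v\<close> by arbitrary ones.
    It loses nothing: if \<open>v\<close> is a sink, every edge at \<open>v\<close> points from its
    other end to \<open>v\<close>, and this is what \<open>?k\<close> restores by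
    \<open>THE\<close>.\<close>
  let ?h = "\<lambda>(d, g) e. if e \<in> ?E then g e else d e"
  let ?k = "\<lambda>d'. (\<lambda>e. if e \<in> ?E then (THE u. ends G e = {u, v} \<and> u \<noteq> v, v) else d' e, restrict d' ?E)"
  have nb: "e \<in> edges G \<Longrightarrow> d \<in> orientations G \<Longrightarrow> v \<in> ends G e \<Longrightarrow> w \<in> ends G e \<Longrightarrow> w \<noteq> v
      \<Longrightarrow> w \<in> neighbours G v" for e d w
    using ends_orientation[of d G e] by (auto simp: neighbours_def)
  have toward: "d e = (THE u. ends G e = {u, v} \<and> u \<noteq> v, v)"
    if "d \<in> orientations G" "is_sink G d v" "e \<in> ?E" for d e
  proof -
    have en: "ends G e = {fst (d e), snd (d e)}" and ne: "fst (d e) \<noteq> v"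
      using that ends_orientation[of d G e] by (auto simp: is_sink_def)
    with that have "snd (d e) = v" by auto
    moreover from this have "(THE u. ends G e = {u, v} \<and> u \<noteq> v) = fst (d e)"
      using en ne by (intro the_equality) (auto simp: doubleton_eq_iff)
    ultimately show ?thesis by (metis prod.collapse)
  qed
  have AB: "?h (d, g) \<in> ?C \<and> ?k (?h (d, g)) = (d, g)" if "d \<in> ?A" "g \<in> ?B" for d g
  proof
    have d: "d \<in> orientations G" "is_sink G d v" and nons: "\<And>u. u \<in> U \<Longrightarrow> \<not> is_sink G d u"
      using that by (auto simp: nonsinks_def)
    have h: "?h (d, g) \<in> orientations G"
      using d(1) that(2) unfolding orientations_def by (auto simp: PiE_def Pi_def extensional_def)
    have "\<not> is_sink G (?h (d, g)) u" if u: "u \<in> U - neighbours G v" for u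
    proof -
      obtain e where e: "e \<in> edges G" "fst (d e) = u" using nons[of u] u by (auto simp: is_sink_def)
      have "u \<noteq> v" using u v by auto
      then have "e \<notin> ?E" using nb[OF e(1) d(1), of u] ends_orientation[OF d(1) e(1)] e u by auto
      then show ?thesis using e by (auto simp: is_sink_def)
    qed
    then show "?h (d, g) \<in> ?C" using h by (auto simp: nonsinks_def)
    have "restrict (?h (d, g)) ?E = g"
      using that(2) by (auto simp: PiE_def extensional_def)
    moreover have "(\<lambda>e. if e \<in> ?E then (THE u. ends G e = {u, v} \<and> u \<noteq> v, v) else ?h (d, g) e) = d"
      using toward[OF d] by (auto simp: fun_eq_iff)
    ultimately show "?k (?h (d, g)) = (d, g)" by simp
  qed
  have C: "?k d' \<in> ?A \<times> ?B \<and> ?h (?k d') = d'" if "d' \<in> ?C" for d'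
  proof -
    have d': "d' \<in> orientations G" and nons: "\<And>u. u \<in> U - neighbours G v \<Longrightarrow> \<not> is_sink G d' u"
      using that by (auto simp: nonsinks_def)
    define d where "d = fst (?k d')"
    have d_out: "d e = d' e" if "e \<notin> ?E" for e using that unfolding d_def by auto
    have at_v: "\<exists>u. u \<noteq> v \<and> ends G e = {u, v} \<and> d e = (u, v)" if "e \<in> ?E" for e
    proof -
      have "\<exists>u. u \<noteq> v \<and> ends G e = {u, v}"
        using ends_orientation[OF d', of e] not_loop[OF wf d', of e] that
        by (auto intro: exI[of _ "fst (d' e)"] exI[of _ "snd (d' e)"])
      then obtain u where u: "u \<noteq> v" "ends G e = {u, v}" by blast
      then have "(THE u. ends G e = {u, v} \<and> u \<noteq> v) = u"
        by (intro the_equality) (auto simp: doubleton_eq_iff)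
      with u that show ?thesis unfolding d_def by auto
    qed
    have or: "d \<in> orientations G"
      unfolding orientations_def
    proof (intro PiE_I)
      fix e assume e: "e \<in> edges G"
      show "d e \<in> ?D e"
      proof (cases "e \<in> ?E")
        case True
        then obtain u where "ends G e = {u, v}" "d e = (u, v)" using at_v[of e] by blast
        then show ?thesis by simp
      next
        case False
        then show ?thesis using d_out[of e] ends_orientation[OF d' e] by (cases "d' e") simp
      qed
    next
      fix e assume e: "e \<notin> edges G"
      then have "d e = d' e" by (intro d_out) simp
      then show "d e = undefined" using d' e by (auto simp: orientations_def PiE_def extensional_def)
    qed
    have sink: "is_sink G d v"
      unfolding is_sink_def
    proof
      assume "\<exists>e\<in>edges G. fst (d e) = v"
      then obtain e where e: "e \<in> edges G" "fst (d e) = v" by blast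
      then have "e \<in> ?E" using ends_orientation[OF or e(1)] by auto
      then obtain u where "u \<noteq> v" "d e = (u, v)" using at_v[of e] by blast
      then show False using e(2) by simp
    qed
    \<comment> \<open>A neighbour of \<open>v\<close> has an outgoing edge, namely one to the sink
      \<open>v\<close>. Any other member of \<open>U\<close> keeps the outgoing edge it had in
      \<open>d'\<close>, since that edge misses \<open>v\<close>.\<close>
    have "\<not> is_sink G d u" if u: "u \<in> U" for u
    proof (cases "u \<in> neighbours G v")
      case True
      then obtain e where e: "e \<in> edges G" "ends G e = {v, u}" by (auto simp: neighbours_def)
      then obtain w where "w \<noteq> v" "ends G e = {w, v}" "d e = (w, v)" using at_v[of e] by blast
      moreover from this have "w = u" using e by (auto simp: doubleton_eq_iff)
      ultimately show ?thesis using e unfolding is_sink_def by (metis fst_conv)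
    next
      case False
      then obtain e where e: "e \<in> edges G" "fst (d' e) = u" using nons[of u] u by (auto simp: is_sink_def)
      have "u \<noteq> v" using u v by auto
      then have "e \<notin> ?E" using nb[OF e(1) d', of u] ends_orientation[OF d' e(1)] e False by auto
      then have "d e = d' e" by (rule d_out)
      then show ?thesis using e unfolding is_sink_def by metis
    qed
    then have "d \<in> ?A" using or sink by (simp add: nonsinks_def)
    moreover have "restrict d' ?E \<in> ?B"
      using d' unfolding orientations_def by (intro restrict_PiE_iff[THEN iffD2]) (simp add: PiE_iff)
    moreover have "?h (?k d') = d'" by (rule ext) simp
    ultimately show ?thesis unfolding d_def by simp
  qed
  have "bij_betw ?h (?A \<times> ?B) ?C"
  proof (rule bij_betw_byWitness[where f' = ?k])
    show "\<forall>a\<in>?A \<times> ?B. ?k (?h a) = a" using AB by blast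
    show "\<forall>a'\<in>?C. ?h (?k a') = a'" using C by blast
    show "?h ` (?A \<times> ?B) \<subseteq> ?C" using AB by blast
    show "?k ` ?C \<subseteq> ?A \<times> ?B" using C[THEN conjunct1] by (rule image_subsetI)
  qed
  then have "card (?A \<times> ?B) = card ?C" by (rule bij_betw_same_card)
  moreover have "card ?B = 2 ^ vdegree G v"
    unfolding vdegree_def by (rule card_PiE_directions[OF wf]) auto
  ultimately show ?thesis by (simp add: card_cartesian_product)
qed

lemma card_nonsinks_insert:
  assumes wf: "wf_multigraph G" and v: "v \<notin> U"
  shows "real (card (nonsinks G (insert v U)))
    = real (card (nonsinks G U)) - real (card (nonsinks G (U - neighbours G v))) / 2 ^ vdegree G v"
proof -
  let ?A = "{d \<in> nonsinks G U. is_sink G d v}"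
  have "nonsinks G U = nonsinks G (insert v U) \<union> ?A" "nonsinks G (insert v U) \<inter> ?A = {}"
    by (auto simp: nonsinks_def)
  moreover have "finite ?A" using finite_nonsinks[OF wf, of U] by auto
  ultimately have "card (nonsinks G U) = card (nonsinks G (insert v U)) + card ?A"
    using finite_nonsinks[OF wf] by (metis (no_types, lifting) card_Un_disjoint)
  moreover have "real (card ?A) = real (card (nonsinks G (U - neighbours G v))) / 2 ^ vdegree G v"
    using arg_cong[OF card_sink_nonsinks[OF wf v], of real] by (simp add: field_simps)
  ultimately show ?thesis by simp
qed

lemma handshake:
  assumes "wf_multigraph G"
  shows "(\<Sum>v\<in>verts G. vdegree G v) = 2 * card (edges G)"
proof -
  have fin: "finite (verts G)" "finite (edges G)" using assms by (auto simp: wf_multigraph_def)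
  have "(\<Sum>v\<in>verts G. vdegree G v) = (\<Sum>v\<in>verts G. \<Sum>e\<in>edges G. if v \<in> ends G e then 1 else 0)"
    using fin by (simp add: vdegree_def sum.If_cases Int_def)
  also have "\<dots> = (\<Sum>e\<in>edges G. \<Sum>v\<in>verts G. if v \<in> ends G e then 1 else 0)"
    by (rule sum.swap)
  also have "\<dots> = (\<Sum>e\<in>edges G. card (verts G \<inter> ends G e))"
    using fin by (simp add: sum.If_cases Int_def)
  also have "\<dots> = (\<Sum>e\<in>edges G. 2)"
    using assms by (intro sum.cong refl) (auto simp: wf_multigraph_def Int_absorb1)
  finally show ?thesis by simp
qed


section \<open>Truncated recursion for the ratios\<close>

lemma diff_length_less: "\<not> b < length xs \<Longrightarrow> xs \<noteq> [] \<Longrightarrow> b - length xs < b"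
  by (cases xs) auto

text \<open>
  Fixed-point arithmetic with scale \<open>S\<close>: \<open>marginal S nb b R v\<close> approximates \<open>S\<close> times the
  probability that \<open>v\<close> is no sink given that no vertex outside \<open>R\<close> is one (where \<open>v \<in> R\<close>). Every visited
  vertex consumes its degree from the budget \<open>b\<close>, and a vertex that cannot be paid for is treated as
  never being a sink, so vertices of huge degree are not scanned.
\<close>

function marginal :: "nat \<Rightarrow> ('v \<Rightarrow> 'v list) \<Rightarrow> nat \<Rightarrow> 'v set \<Rightarrow> 'v \<Rightarrow> nat"
  and blocked :: "nat \<Rightarrow> ('v \<Rightarrow> 'v list) \<Rightarrow> nat \<Rightarrow> 'v set \<Rightarrow> 'v list \<Rightarrow> nat \<Rightarrow> nat" where
  "marginal S nb b R v = (if b < length (nb v) \<or> nb v = [] then S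
     else S - blocked S nb (b - length (nb v)) R (nb v) S)"
| "blocked S nb b R [] p = p"
| "blocked S nb b R (u # us) p = (if u \<in> R then blocked S nb b R us (p div 2)
     else blocked S nb b (insert u R) us (p div 2 * S div marginal S nb b (insert u R) u))"
  by pat_completeness auto
termination
  by (relation "measures [\<lambda>x. case x of Inl (S, nb, b, R, v) \<Rightarrow> b | Inr (S, nb, b, R, us, p) \<Rightarrow> b,
      \<lambda>x. case x of Inl (S, nb, b, R, v) \<Rightarrow> 0 | Inr (S, nb, b, R, us, p) \<Rightarrow> Suc (length us)]")
    (auto simp: diff_length_less)

declare marginal.simps [simp del]

section \<open>Error recurrence: contraction and rounding\<close>

definition err :: "nat \<Rightarrow> nat \<Rightarrow> real" where
  "err S b = (39/40) ^ b + 96 / real S"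

lemma err_nonneg: "0 \<le> err S b" by (simp add: err_def)

text \<open>The left side is the amplification of the children's errors: \<open>d\<close> factors,
  each with relative error at most 5/4 times the absolute one, in a product of size at most
  \<open>(5/8) ^ d\<close>. From \<open>d\<close> to \<open>d + 1\<close> it shrinks by at least the
  factor 5/6, so degree 3 is decisive.\<close>

lemma contraction: "3 \<le> d \<Longrightarrow> real d * (5/4) * (5/8) ^ d \<le> (39/40) ^ d"
proof (induction d rule: nat_induct_at_least)
  case base
  show ?case by (simp add: power3_eq_cube)
next
  case (Suc d)
  have "real (Suc d) * (5/4) * (5/8) ^ Suc d \<le> (real d * (5/4) * (5/8) ^ d) * (39/40)"
  proof -
    have "real (Suc d) * (5/8) \<le> real d * (39/40)" using Suc by simp
    then have "real (Suc d) * (5/8) * ((5/4) * (5/8) ^ d) \<le> real d * (39/40) * ((5/4) * (5/8) ^ d)"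
      by (rule mult_right_mono) simp
    then show ?thesis by (simp add: algebra_simps)
  qed
  also have "\<dots> \<le> (39/40) ^ d * (39/40)" using Suc by (intro mult_right_mono) auto
  finally show ?case by simp
qed

lemma weak_contraction: "3 \<le> d \<Longrightarrow> real d * (5/4) * (5/8) ^ d \<le> 15/16"
proof (induction d rule: nat_induct_at_least)
  case base
  show ?case by (simp add: power3_eq_cube)
next
  case (Suc d)
  have "real (Suc d) * (5/8) \<le> real d" using Suc by simp
  then have "real (Suc d) * (5/8) * ((5/4) * (5/8) ^ d) \<le> real d * ((5/4) * (5/8) ^ d)"
    by (rule mult_right_mono) simp
  also have "\<dots> \<le> 15/16" using Suc.IH by (simp add: mult.assoc)
  finally show ?case by (simp add: mult.assoc mult.left_commute)
qed

text \<open>The truncation part of \<open>err\<close> is multiplicative in the budget. The rounding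
  part does not depend on the budget and must reproduce itself: 96 solves
  \<open>15/16 * x + 6 = x\<close>, where 6 bounds the rounding within one list.\<close>

lemma err_step:
  assumes "3 \<le> d" "d \<le> b"
  shows "real d * (5/4) * (5/8) ^ d * err S (b - d) + 6 / real S \<le> err S b"
proof -
  have "real d * (5/4) * (5/8) ^ d * (39/40) ^ (b - d) \<le> (39/40) ^ d * (39/40) ^ (b - d)"
    using contraction[OF assms(1)] by (intro mult_right_mono) auto
  also have "\<dots> = (39/40) ^ b" using assms by (simp flip: power_add)
  moreover have "real d * (5/4) * (5/8) ^ d * (96 / real S) \<le> 15/16 * (96 / real S)"
    using weak_contraction[OF assms(1)] by (intro mult_right_mono) auto
  ultimately show ?thesis by (simp add: err_def distrib_left)
qed

text \<open>Induction step for one list entry, after which the error \<open>D\<close> of the product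
  so far has become \<open>5/8 * D + 25/32 * x * E + 2 / S\<close>. Since 25/32 is 5/8 times 5/4,
  the middle term supplies one more of the \<open>Suc k\<close> equal terms. Since 16/3 is 2 / (1 -
  5/8), the last summand is the partial geometric series of the rounding errors.\<close>

lemma error_accumulates:
  fixes S E x x' y z D :: real
  assumes "S > 0" "E \<ge> 0" "x' \<le> 5/8 * x" "y \<le> (5/8) ^ k * x'" "0 \<le> z"
    and z: "z \<le> (5/8) ^ k * (5/8 * D + 25/32 * x * E + 2 / S) + real k * (5/4) * (5/8) ^ k * x' * E
      + 16/3 * (1 - (5/8) ^ k) / S"
  shows "0 \<le> z \<and> z \<le> (5/8) ^ Suc k * D + real (Suc k) * (5/4) * (5/8) ^ Suc k * x * E
    + 16/3 * (1 - (5/8) ^ Suc k) / S \<and> y \<le> (5/8) ^ Suc k * x"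
proof -
  have "real k * (5/4) * (5/8) ^ k * x' * E \<le> real k * (5/4) * (5/8) ^ k * (5/8 * x) * E"
    using assms by (intro mult_right_mono mult_left_mono) auto
  moreover have "(5/8) ^ k * x' \<le> (5/8) ^ k * (5/8 * x)"
    using assms by (intro mult_left_mono) auto
  moreover have "(5/8) ^ k * (5/8 * D + 25/32 * x * E + 2 / S) + real k * (5/4) * (5/8) ^ k * (5/8 * x) * E
      + 16/3 * (1 - (5/8) ^ k) / S
    = (5/8) ^ Suc k * D + real (Suc k) * (5/4) * (5/8) ^ Suc k * x * E + 16/3 * (1 - (5/8) ^ Suc k) / S"
  proof -
    define P where "P = (5/8::real) ^ k"
    have "(5/8::real) ^ Suc k = 5/8 * P" by (simp add: P_def)
    then show ?thesis unfolding P_def[symmetric] using \<open>S > 0\<close> by (simp add: field_simps)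
  qed
  moreover have "(5/8) ^ Suc k * x = (5/8) ^ k * (5/8 * x)" by simp
  ultimately show ?thesis using assms(4,5) z by linarith
qed

text \<open>Two integer divisions round down, each losing at most \<open>1 / S\<close>. The
  remaining error splits into that of the numerator, weighted by
  \<open>1 / (2 * h) \<le> 5/8\<close>, and that of the denominator, weighted by
  \<open>x / (2 * (g * h)) \<le> 25/32 * x\<close>.\<close>

lemma divide_by_child:
  fixes p S F :: nat and g x D E :: real
  assumes S: "S > 0" and g: "4/5 \<le> g" "g \<le> F / S" "F / S \<le> g + E" "F \<le> S"
    and x: "0 \<le> x" "0 \<le> x - p / S" "x - p / S \<le> D"
  defines "t \<equiv> real (p div 2 * S div F) / S"
  shows "0 \<le> x / (2 * g) - t" and "x / (2 * g) - t \<le> 5/8 * D + 25/32 * x * E + 2 / S"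
    and "0 \<le> x / (2 * g)" and "x / (2 * g) \<le> 5/8 * x"
proof -
  define h where "h = real F / S"
  define q where "q = real p / S"
  have h: "4/5 \<le> h" "g \<le> h" "h \<le> g + E" using g unfolding h_def by linarith+
  have q: "0 \<le> q" "q \<le> x" "x - q \<le> D" using x by (simp_all add: q_def)
  have F: "real F = h * S" using S by (simp add: h_def)
  have Fpos: "real F > 0" unfolding F using h S by simp
  have ps: "real p = q * S" using S by (simp add: q_def)
  have fl: "real (p div 2 * S div F) \<le> real (p div 2 * S) / F"
    "real (p div 2 * S) / F - 1 \<le> real (p div 2 * S div F)"
    using floor_divide_of_nat_eq[of "p div 2 * S" F, where 'a = real] by linarith+
  have half: "real (p div 2) \<le> q * S / 2" "q * S / 2 - 1 / 2 \<le> real (p div 2)"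
    unfolding ps[symmetric] by linarith+
  have "t \<le> real (p div 2 * S) / F / S" unfolding t_def using fl by (intro divide_right_mono) auto
  also have "\<dots> = real (p div 2) / F" using S by simp
  also have "\<dots> \<le> q * S / 2 / F" using half Fpos by (intro divide_right_mono) auto
  also have "\<dots> = q / (2 * h)" using S h unfolding F by (simp add: field_simps)
  finally have t1: "t \<le> q / (2 * h)" .
  have "(q * S / 2 - 1 / 2) / F \<le> real (p div 2) / F" using half Fpos by (intro divide_right_mono) auto
  also have "\<dots> = real (p div 2 * S) / F / S" using S by simp
  also have "\<dots> \<le> (real (p div 2 * S div F) + 1) / S" using fl by (intro divide_right_mono) auto
  also have "\<dots> = t + 1 / S" by (simp add: t_def add_divide_distrib)
  also have "(q * S / 2 - 1 / 2) / F = q / (2 * h) - 1 / (2 * h) / S"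
    using S h unfolding F by (simp add: field_simps)
  finally have t2: "q / (2 * h) - 1 / (2 * h) / S \<le> t + 1 / S" .
  have "1 / (2 * h) \<le> 1 / 1" using h by (intro divide_left_mono) auto
  then have "1 / (2 * h) / S \<le> 1 / S" by (intro divide_right_mono) auto
  with t2 have t3: "q / (2 * h) - 2 / S \<le> t" by simp
  have split: "x / (2 * g) - q / (2 * h) = (x - q) / (2 * h) + x * (h - g) / (2 * (g * h))"
    using g(1) h by (simp add: field_simps)
  have "(x - q) / (2 * h) \<le> (x - q) / (8/5)" using q h by (intro divide_left_mono) auto
  also have "\<dots> \<le> 5/8 * D" using q by simp
  finally have s1: "(x - q) / (2 * h) \<le> 5/8 * D" .
  have gh: "16/25 \<le> g * h" using mult_mono[of "4/5" g "4/5" h] g(1) h by simp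
  have "x * (h - g) \<le> x * E" using h x by (intro mult_left_mono) auto
  then have "x * (h - g) / (2 * (g * h)) \<le> x * E / (32/25)"
    using gh h x by (intro frac_le) auto
  also have "x * E / (32/25) = 25/32 * x * E" by simp
  finally show "x / (2 * g) - t \<le> 5/8 * D + 25/32 * x * E + 2 / S"
    using s1 split t3 by linarith
  have "0 \<le> (x - q) / (2 * h)" using q h by simp
  moreover have "0 \<le> x * (h - g) / (2 * (g * h))"
    using x(1) h(1,2) g(1) by (intro divide_nonneg_nonneg mult_nonneg_nonneg) auto
  ultimately show "0 \<le> x / (2 * g) - t" using split t1 by linarith
  show "0 \<le> x / (2 * g)" using x g by auto
  have "x / (2 * g) \<le> x / (8/5)" using g x by (intro divide_left_mono) auto
  then show "x / (2 * g) \<le> 5/8 * x" by simp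
qed

section \<open>Ratios of counts and their approximation\<close>

locale sink_free_graph =
  fixes G :: "('v, 'e) multigraph" and nb :: "'v \<Rightarrow> 'v list"
  assumes wf: "wf_multigraph G"
    and degree3: "\<And>v. v \<in> verts G \<Longrightarrow> 3 \<le> vdegree G v"
    and length_nb: "\<And>v. v \<in> verts G \<Longrightarrow> length (nb v) = vdegree G v"
    and set_nb: "\<And>v. v \<in> verts G \<Longrightarrow> set (nb v) = neighbours G v"
begin

definition cnt :: "'v set \<Rightarrow> real" where
  "cnt U = real (card (nonsinks G U))"

definition ratio :: "'v \<Rightarrow> 'v set \<Rightarrow> real" where
  "ratio v U = cnt (insert v U) / cnt U"

lemma cnt_insert: "v \<notin> U \<Longrightarrow> cnt (insert v U) = cnt U - cnt (U - neighbours G v) / 2 ^ vdegree G v"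
  unfolding cnt_def by (rule card_nonsinks_insert[OF wf])

lemma nb_verts: "v \<in> verts G \<Longrightarrow> u \<in> set (nb v) \<Longrightarrow> u \<in> verts G"
  using wf set_nb by (auto simp: neighbours_def wf_multigraph_def)

lemma nb_sym: "v \<in> verts G \<Longrightarrow> u \<in> set (nb v) \<Longrightarrow> v \<in> set (nb u)"
  using nb_verts[of v u] set_nb by (auto simp: neighbours_def insert_commute)

text \<open>The vertices are removed one after the other, each at the cost of a factor 5/4. Entries
  outside \<open>U\<close> cost nothing; a neighbour removed earlier thus saves a factor.\<close>

lemma cnt_Diff_list:
  assumes "\<And>u U'. u \<in> set us \<Longrightarrow> u \<notin> U' \<Longrightarrow> insert u U' \<subseteq> U \<Longrightarrow> cnt U' > 0 \<and> 4/5 * cnt U' \<le> cnt (insert u U')"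
    and "cnt U > 0"
  shows "cnt (U - set us) \<le> (5/4) ^ length (filter (\<lambda>u. u \<in> U) us) * cnt U \<and> cnt (U - set us) > 0"
  using assms
proof (induction us arbitrary: U)
  case (Cons u us)
  show ?case
  proof (cases "u \<in> U")
    case False
    then have "U - set (u # us) = U - set us" by auto
    then show ?thesis using Cons.IH[of U] Cons.prems False by auto
  next
    case True
    have *: "cnt (U - {u}) > 0" "4/5 * cnt (U - {u}) \<le> cnt U"
      using Cons.prems(1)[of u "U - {u}"] True by (auto simp: insert_absorb)
    have IH: "cnt (U - {u} - set us) \<le> (5/4) ^ length (filter (\<lambda>w. w \<in> U - {u}) us) * cnt (U - {u}) \<and> cnt (U - {u} - set us) > 0"
      using Cons.prems(1) * by (intro Cons.IH) auto
    \<comment> \<open>With parallel edges the list may repeat \<open>u\<close>. Once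
      \<open>u\<close> is removed, its later entries are filtered out too, so the exponent can only
      drop.\<close>
    have le: "(5/4::real) ^ length (filter (\<lambda>w. w \<in> U - {u}) us) * cnt (U - {u})
        \<le> (5/4) ^ length (filter (\<lambda>w. w \<in> U) us) * (5/4 * cnt U)"
    proof (intro mult_mono power_increasing)
      have "filter (\<lambda>w. w \<in> U - {u}) us = filter (\<lambda>w. w \<noteq> u) (filter (\<lambda>w. w \<in> U) us)" by (simp add: conj_commute)
      then show "length (filter (\<lambda>w. w \<in> U - {u}) us) \<le> length (filter (\<lambda>w. w \<in> U) us)"
        by (metis length_filter_le)
    qed (use * in auto)
    have diff: "U - set (u # us) = U - {u} - set us" by auto
    have "(5/4::real) ^ length (filter (\<lambda>w. w \<in> U) us) * (5/4 * cnt U)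
        = (5/4) ^ length (filter (\<lambda>w. w \<in> U) (u # us)) * cnt U" using True by simp
    with IH le show ?thesis unfolding diff by linarith
  qed
qed auto

lemma power_5_8: "3 \<le> d \<Longrightarrow> (5/8::real) ^ d \<le> 1/4"
  using power_decreasing[of 3 d "5/8::real"] by (simp add: power3_eq_cube)

text \<open>
  The ratio at \<open>v\<close> is 1 minus a product of at most \<open>d\<close> inverse ratios at neighbours, divided by
  \<open>2 ^ d\<close>. The bound 4/5 reproduces itself because \<open>1 - (5/4) ^ (d - 1) / 2 ^ d \<ge> 4/5\<close>, but this
  needs one factor to be absent, i.e. a neighbour of \<open>v\<close> that has already been removed.
\<close>

lemma cnt_bounds:
  assumes "finite U" "U \<subseteq> verts G" "v \<in> verts G" "v \<notin> U"
  shows "cnt U > 0 \<and> cnt (insert v U) \<ge> 3/4 * cnt U \<and>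
    (\<not> neighbours G v \<subseteq> U \<longrightarrow> cnt (insert v U) \<ge> 4/5 * cnt U)"
  using assms
proof (induction "card U" arbitrary: U v rule: less_induct)
  case less
  have pos: "cnt U > 0"
  proof (cases "U = {}")
    case True
    then have "nonsinks G U = orientations G" by (auto simp: nonsinks_def)
    then show ?thesis using card_orientations[OF wf] by (simp add: cnt_def)
  next
    case False
    then obtain u where u: "u \<in> U" by blast
    have "card (U - {u}) < card U" using less.prems u by (intro psubset_card_mono) auto
    moreover have "finite (U - {u})" "U - {u} \<subseteq> verts G" "u \<in> verts G" "u \<notin> U - {u}"
      using less.prems u by auto
    ultimately have "cnt (U - {u}) > 0 \<and> cnt (insert u (U - {u})) \<ge> 3/4 * cnt (U - {u})"
      using less.hyps by blast
    then show ?thesis using u by (simp add: insert_absorb)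
  qed
  let ?d = "vdegree G v"
  let ?k = "length (filter (\<lambda>u. u \<in> U) (nb v))"
  have *: "cnt (U - set (nb v)) \<le> (5/4) ^ ?k * cnt U \<and> cnt (U - set (nb v)) > 0"
  proof (rule cnt_Diff_list)
    fix u U' assume u: "u \<in> set (nb v)" "u \<notin> U'" "insert u U' \<subseteq> U"
    then have "card U' < card U" using less.prems(1) by (intro psubset_card_mono) auto
    \<comment> \<open>\<open>v\<close> lies outside \<open>U\<close> and hence outside
      \<open>U'\<close>, so \<open>u\<close> has a neighbour outside \<open>U'\<close> and the
      induction hypothesis gives the better bound 4/5.\<close>
    moreover have "v \<in> neighbours G u" using nb_sym[of v u] nb_verts[of v u] set_nb u less.prems by auto
    ultimately show "cnt U' > 0 \<and> 4/5 * cnt U' \<le> cnt (insert u U')"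
      using less.hyps[of U' u] less.prems u finite_subset[of U' U] by auto
  qed (rule pos)
  have "3 \<le> ?d" using degree3 less.prems by auto
  have ins: "cnt (insert v U) = cnt U - cnt (U - set (nb v)) / 2 ^ ?d"
    using cnt_insert less.prems set_nb by simp
  have bound: "cnt (U - set (nb v)) / 2 ^ ?d \<le> c * cnt U" if "(5/4) ^ ?k / 2 ^ ?d \<le> c" for c
  proof -
    have "cnt (U - set (nb v)) / 2 ^ ?d \<le> (5/4) ^ ?k * cnt U / 2 ^ ?d" using * by (simp add: divide_right_mono)
    also have "\<dots> = (5/4) ^ ?k / 2 ^ ?d * cnt U" by simp
    also have "\<dots> \<le> c * cnt U" using that pos by (intro mult_right_mono) auto
    finally show ?thesis .
  qed
  have len: "length (nb v) = ?d" using length_nb less.prems by simp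
  have pw: "(5/4::real) ^ ?d / 2 ^ ?d = (5/8) ^ ?d" by (simp flip: power_divide)
  have "(5/4::real) ^ ?k / 2 ^ ?d \<le> (5/4) ^ ?d / 2 ^ ?d"
    using len length_filter_le[of "\<lambda>u. u \<in> U" "nb v"] by (intro divide_right_mono power_increasing) auto
  also have "\<dots> \<le> 1/4" unfolding pw using power_5_8 \<open>3 \<le> ?d\<close> by blast
  finally have 1: "cnt (insert v U) \<ge> 3/4 * cnt U" using bound[of "1/4"] ins by simp
  have 2: "cnt (insert v U) \<ge> 4/5 * cnt U" if out: "\<not> neighbours G v \<subseteq> U"
  proof -
    have "?k < ?d" using out set_nb[of v] less.prems len length_filter_less[of _ "nb v" "\<lambda>u. u \<in> U"] by auto
    then have "(5/4::real) ^ ?k / 2 ^ ?d \<le> (5/4) ^ (?d - 1) / 2 ^ ?d"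
      by (intro divide_right_mono power_increasing) auto
    also have "\<dots> = 4/5 * ((5/4) ^ ?d / 2 ^ ?d)" using \<open>3 \<le> ?d\<close> by (cases ?d) auto
    also have "\<dots> \<le> 1/5" unfolding pw using power_5_8[OF \<open>3 \<le> ?d\<close>] by simp
    finally show ?thesis using bound[of "1/5"] ins by simp
  qed
  show ?case using pos 1 2 by blast
qed

text \<open>\<open>cnt_bounds\<close> speaks of sets that leave out some vertex. To reach
  \<open>verts G\<close> itself, one vertex is taken out first and put back by the bound
  3/4.\<close>

lemma cnt_pos: 
  assumes "U \<subseteq> verts G"
  shows "cnt U > 0"
proof (cases "U = {}")
  case True
  then have "nonsinks G U = orientations G" by (auto simp: nonsinks_def)
  then show ?thesis using card_orientations[OF wf] by (simp add: cnt_def)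
next
  case False
  then obtain u where u: "u \<in> U" by blast
  have "finite U" using assms wf by (auto simp: wf_multigraph_def intro: finite_subset)
  then have "cnt (U - {u}) > 0 \<and> cnt (insert u (U - {u})) \<ge> 3/4 * cnt (U - {u})"
    using cnt_bounds[of "U - {u}" u] assms u by auto
  then show ?thesis using u by (auto simp: insert_absorb)
qed

lemma ratio_ge:
  assumes "U \<subseteq> verts G" "v \<in> verts G" "v \<notin> U"
  shows "ratio v U \<ge> 3/4" and "\<not> neighbours G v \<subseteq> U \<Longrightarrow> ratio v U \<ge> 4/5"
proof -
  have "finite U" using assms wf by (auto simp: wf_multigraph_def intro: finite_subset)
  from cnt_bounds[OF this assms] show "ratio v U \<ge> 3/4" "\<not> neighbours G v \<subseteq> U \<Longrightarrow> ratio v U \<ge> 4/5"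
    by (auto simp: ratio_def field_simps)
qed

lemma ratio_le_1: "ratio v U \<le> 1"
proof -
  have "card (nonsinks G (insert v U)) \<le> card (nonsinks G U)"
    using finite_nonsinks[OF wf] by (intro card_mono) (auto simp: nonsinks_def)
  then show ?thesis by (auto simp: ratio_def cnt_def divide_simps)
qed

text \<open>
  All truncation and rounding errors point in the same direction (\<open>marginal\<close> is too large,
  \<open>blocked\<close> too small), so the approximations inherit the lower bound 4/5.
\<close>

lemma blocked_error:
  assumes S: "S > 0" and E: "E \<ge> 0"
    and F: "\<And>u R. u \<in> set us \<Longrightarrow> u \<in> R \<Longrightarrow> v \<in> R \<Longrightarrow> ratio u (verts G - R) \<ge> 4/5 \<and>
       ratio u (verts G - R) \<le> marginal S nb b R u / S \<and> marginal S nb b R u / S \<le> ratio u (verts G - R) + E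
       \<and> marginal S nb b R u \<le> S"
    and "set us \<subseteq> verts G" "v \<in> R"
    and "0 \<le> x" "0 \<le> x - p / S" "x - p / S \<le> D"
  defines "y \<equiv> x / 2 ^ length us * cnt (verts G - R - set us) / cnt (verts G - R)"
  defines "q \<equiv> real (blocked S nb b R us p) / S"
  shows "0 \<le> y - q \<and> y - q \<le> (5/8) ^ length us * D + length us * (5/4) * (5/8) ^ length us * x * E
    + 16/3 * (1 - (5/8) ^ length us) / S \<and> y \<le> (5/8) ^ length us * x"
  using F assms(4-8) unfolding y_def q_def
proof (induction us arbitrary: R x p D)
  case Nil
  then show ?case using cnt_pos[of "verts G - R"] by auto
next
  case (Cons u us)
  let ?U = "verts G - R"
  show ?case
  proof (cases "u \<in> R")
    case True
    let ?p = "p div 2"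
    have eq: "?U - set (u # us) = ?U - set us" using True by auto
    have p: "real ?p \<le> real p / 2" "real p / 2 - 1 / 2 \<le> real ?p" by linarith+
    define q t where "q = real p / S" and "t = real ?p / S"
    have q: "0 \<le> q" "q \<le> x" "x - q \<le> D" using Cons.prems S by (auto simp: q_def)
    have p1: "t \<le> q / 2" using p S by (simp add: q_def t_def field_simps)
    have "q / 2 - 1 / 2 / S = (real p / 2 - 1 / 2) / S" by (simp add: q_def diff_divide_distrib)
    also have "\<dots> \<le> t" unfolding t_def using p by (intro divide_right_mono) auto
    finally have p2: "q / 2 - 1 / 2 / S \<le> t" .
    have "1 / 2 / S \<le> 2 / S" using S by (simp add: field_simps)
    moreover have "0 \<le> x * E" using Cons.prems E by simp
    \<comment> \<open>A removed or repeated entry only halves the product. As 1/2 is below 5/8, this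
      case fits the same recurrence as a genuine child.\<close>
    ultimately have *: "x / 2 - t \<le> 5/8 * D + 25/32 * x * E + 2 / S" "0 \<le> x / 2 - t"
      using p1 p2 q by linarith+
    have yeq: "x / 2 ^ length (u # us) * cnt (?U - set (u # us)) / cnt ?U
      = x / 2 / 2 ^ length us * cnt (?U - set us) / cnt ?U" unfolding eq by simp
    have beq: "blocked S nb b R (u # us) p = blocked S nb b R us ?p" using True by simp
    have IH: "0 \<le> x / 2 / 2 ^ length us * cnt (?U - set us) / cnt ?U - blocked S nb b R us ?p / S
      \<and> x / 2 / 2 ^ length us * cnt (?U - set us) / cnt ?U - blocked S nb b R us ?p / S
        \<le> (5/8) ^ length us * (5/8 * D + 25/32 * x * E + 2 / S) + length us * (5/4) * (5/8) ^ length us * (x / 2) * E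
          + 16/3 * (1 - (5/8) ^ length us) / S
      \<and> x / 2 / 2 ^ length us * cnt (?U - set us) / cnt ?U \<le> (5/8) ^ length us * (x / 2)"
      using Cons.prems * unfolding t_def by (intro Cons.IH) auto
    show ?thesis unfolding yeq beq unfolding length_Cons
      by (rule error_accumulates[of _ _ "x / 2"]) (use IH S E Cons.prems in auto)
  next
    case False
    let ?R = "insert u R"
    let ?F = "marginal S nb b ?R u"
    let ?p = "p div 2 * S div ?F"
    let ?g = "ratio u (verts G - ?R)"
    let ?h = "real ?F / S"
    let ?x = "x / (2 * ?g)"
    have uV: "u \<in> verts G" using Cons.prems by auto
    have F: "?g \<ge> 4/5" "?g \<le> ?h" "?h \<le> ?g + E" "?F \<le> S"
      using Cons.prems(1)[of u ?R] Cons.prems by auto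
    have U: "insert u (verts G - ?R) = ?U" using uV False by auto
    have g: "?g = cnt ?U / cnt (verts G - ?R)" unfolding ratio_def U ..
    have pos: "cnt ?U > 0" "cnt (verts G - ?R) > 0" by (auto intro: cnt_pos)
    have eq: "?U - set (u # us) = verts G - ?R - set us" by auto
    \<comment> \<open>Telescoping: removing \<open>u\<close> contributes the factor
      \<open>cnt (verts G - ?R) / cnt ?U\<close>, which is \<open>1 / ?g\<close>; together with one
      halving it is moved into \<open>?x\<close>.\<close>
    have yeq: "x / 2 ^ length (u # us) * cnt (?U - set (u # us)) / cnt ?U
      = ?x / 2 ^ length us * cnt (verts G - ?R - set us) / cnt (verts G - ?R)"
      unfolding eq g using pos by (simp add: field_simps)
    note step = divide_by_child[OF S F(1,2,3,4) Cons.prems(4,5,6)]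
    have IH: "0 \<le> ?x / 2 ^ length us * cnt (verts G - ?R - set us) / cnt (verts G - ?R) - blocked S nb b ?R us ?p / S
      \<and> ?x / 2 ^ length us * cnt (verts G - ?R - set us) / cnt (verts G - ?R) - blocked S nb b ?R us ?p / S
        \<le> (5/8) ^ length us * (5/8 * D + 25/32 * x * E + 2 / S) + length us * (5/4) * (5/8) ^ length us * ?x * E
          + 16/3 * (1 - (5/8) ^ length us) / S
      \<and> ?x / 2 ^ length us * cnt (verts G - ?R - set us) / cnt (verts G - ?R) \<le> (5/8) ^ length us * ?x"
      using Cons.prems step(1-3) by (intro Cons.IH) auto
    have beq: "blocked S nb b R (u # us) p = blocked S nb b ?R us ?p" using False by simp
    show ?thesis unfolding yeq beq unfolding length_Cons
      by (rule error_accumulates[of _ _ ?x]) (use IH S E step(4) in auto)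
  qed
qed

text \<open>Induction on the budget. Every child of \<open>v\<close> is evaluated with its neighbour
  \<open>v\<close> already removed, so the bound 4/5 needed for \<open>blocked_error\<close> holds
  for all children, even if \<open>v\<close> itself only satisfies 3/4.\<close>

lemma marginal_error:
  assumes "S > 0" "v \<in> verts G" "v \<in> R"
  shows "ratio v (verts G - R) \<le> marginal S nb b R v / S
    \<and> marginal S nb b R v / S \<le> ratio v (verts G - R) + err S b \<and> marginal S nb b R v \<le> S"
  using assms
proof (induction b arbitrary: v R rule: less_induct)
  case (less b)
  let ?U = "verts G - R" and ?d = "vdegree G v"
  have len: "length (nb v) = ?d" and d: "3 \<le> ?d" using length_nb degree3 less.prems by auto
  then have ne: "nb v \<noteq> []" by auto
  have pos: "cnt ?U > 0" by (auto intro: cnt_pos)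
  let ?y = "cnt (?U - set (nb v)) / cnt ?U / 2 ^ ?d"
  have ratio: "ratio v ?U = 1 - ?y"
    using cnt_insert[of v ?U] set_nb[of v] less.prems pos by (simp add: ratio_def field_simps)
  have children: "ratio u (verts G - R') \<ge> 4/5" if "u \<in> set (nb v)" "u \<in> R'" "v \<in> R'" for u R'
    using nb_sym[of v u] nb_verts[of v u] set_nb[of u] that less.prems by (intro ratio_ge(2)) auto
  have main: "0 \<le> ?y - real (blocked S nb b' R (nb v) S) / S \<and>
      ?y - real (blocked S nb b' R (nb v) S) / S \<le> real ?d * (5/4) * (5/8) ^ ?d * err S b' + 6 / S \<and> ?y \<le> (5/8) ^ ?d"
    if "b' < b" for b'
  proof -
    have "0 \<le> 1 / 2 ^ length (nb v) * cnt (?U - set (nb v)) / cnt ?U - real (blocked S nb b' R (nb v) S) / S \<and>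
      1 / 2 ^ length (nb v) * cnt (?U - set (nb v)) / cnt ?U - real (blocked S nb b' R (nb v) S) / S
        \<le> (5/8) ^ length (nb v) * 0 + length (nb v) * (5/4) * (5/8) ^ length (nb v) * 1 * err S b'
         + 16/3 * (1 - (5/8) ^ length (nb v)) / S
      \<and> 1 / 2 ^ length (nb v) * cnt (?U - set (nb v)) / cnt ?U \<le> (5/8) ^ length (nb v) * 1"
    proof (rule blocked_error)
      fix u R' assume u: "u \<in> set (nb v)" "u \<in> R'" "v \<in> R'"
      show "4/5 \<le> ratio u (verts G - R') \<and> ratio u (verts G - R') \<le> marginal S nb b' R' u / S \<and>
         marginal S nb b' R' u / S \<le> ratio u (verts G - R') + err S b' \<and> marginal S nb b' R' u \<le> S"
        using less.IH[OF that less.prems(1) nb_verts[OF _ u(1)] u(2)] children[OF u] less.prems by auto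
    qed (use less.prems nb_verts err_nonneg in auto)
    moreover have "16/3 * (1 - (5/8) ^ length (nb v)) / S \<le> 6 / S"
    proof (intro divide_right_mono)
      have "0 \<le> (5/8::real) ^ length (nb v)" by simp
      then show "16/3 * (1 - (5/8::real) ^ length (nb v)) \<le> 6" by argo
    qed simp
    ultimately show ?thesis by (simp add: len mult.commute)
  qed
  show ?case
  proof (cases "b < ?d")
    case True
    have y: "0 \<le> ?y" using cnt_pos[of "?U - set (nb v)"] pos by (simp add: less_imp_le Diff_subset subset_iff)
    \<comment> \<open>Only the bound on the exact product is wanted here. Budget 0 and error 1 make
      the hypotheses on the children trivial: all approximate ratios are 1.\<close>
    have y2: "?y \<le> (5/8) ^ ?d"
    proof -
      have "0 \<le> 1 / 2 ^ length (nb v) * cnt (?U - set (nb v)) / cnt ?U - real (blocked S nb 0 R (nb v) S) / S \<and>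
      1 / 2 ^ length (nb v) * cnt (?U - set (nb v)) / cnt ?U - real (blocked S nb 0 R (nb v) S) / S
        \<le> (5/8) ^ length (nb v) * 0 + length (nb v) * (5/4) * (5/8) ^ length (nb v) * 1 * 1
         + 16/3 * (1 - (5/8) ^ length (nb v)) / S
      \<and> 1 / 2 ^ length (nb v) * cnt (?U - set (nb v)) / cnt ?U \<le> (5/8) ^ length (nb v) * 1"
      proof (rule blocked_error)
        fix u R' assume u: "u \<in> set (nb v)" "u \<in> R'" "v \<in> R'"
        have lu: "length (nb u) \<noteq> 0" using degree3[of u] length_nb[of u] nb_verts[of v u] u less.prems by auto
        then have *: "marginal S nb 0 R' u = S" by (simp add: marginal.simps)
        have "ratio u (verts G - R') \<le> 1" by (rule ratio_le_1)
        then show "4/5 \<le> ratio u (verts G - R') \<and> ratio u (verts G - R') \<le> marginal S nb 0 R' u / S \<and>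
         marginal S nb 0 R' u / S \<le> ratio u (verts G - R') + 1 \<and> marginal S nb 0 R' u \<le> S"
          using children[OF u] less.prems * by auto
      qed (use less.prems nb_verts in auto)
      then show ?thesis by (simp add: len mult.commute)
    qed
    have m: "marginal S nb b R v = S" using True len by (simp add: marginal.simps)
    have "(5/8::real) ^ ?d \<le> (39/40) ^ b"
    proof -
      have "(5/8::real) ^ ?d \<le> (39/40) ^ ?d" by (intro power_mono) auto
      also have "\<dots> \<le> (39/40) ^ b" using True by (intro power_decreasing) auto
      finally show ?thesis .
    qed
    also have "\<dots> \<le> err S b" by (simp add: err_def)
    finally show ?thesis using m ratio y y2 less.prems by auto
  next
    case False
    let ?B = "blocked S nb (b - ?d) R (nb v) S"
    have m: "marginal S nb b R v = S - ?B" using False ne len by (simp add: marginal.simps)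
    have M: "0 \<le> ?y - real ?B / S" "?y - real ?B / S \<le> real ?d * (5/4) * (5/8) ^ ?d * err S (b - ?d) + 6 / S"
      "?y \<le> (5/8) ^ ?d" using main[of "b - ?d"] False d by auto
    \<comment> \<open>Since \<open>blocked\<close> errs downwards, it is at most \<open>S\<close>;
      hence the subtraction of natural numbers in \<open>marginal\<close> is exact.\<close>
    have "(5/8::real) ^ ?d \<le> 1" by (intro power_le_one) auto
    then have "real ?B / S \<le> 1" using M by linarith
    then have "?B \<le> S" using less.prems by simp
    then have "real (S - ?B) / S = 1 - real ?B / S" using less.prems by (simp add: of_nat_diff field_simps)
    then show ?thesis using M m ratio err_step[OF d, of b S] False by auto
  qed
qed

end


section \<open>Reachability with time and space bounds\<close>

abbreviation cfg :: "nat \<Rightarrow> (nat \<Rightarrow> nat) \<Rightarrow> (nat \<Rightarrow> nat) \<Rightarrow> config" where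
  "cfg k r m \<equiv> \<lparr>pc = k, regs = r, mem = m\<rparr>"

text \<open>\<open>fits B s\<close> is a premise, so that composition hands it on from segment to
  segment. A segment then only has to bound the values it computes anew; everything it reads is
  already known to fit.\<close>

definition reaches :: "instr list \<Rightarrow> real \<Rightarrow> nat \<Rightarrow> nat \<Rightarrow> config \<Rightarrow> (config \<Rightarrow> bool) \<Rightarrow> bool" where
  "reaches P \<epsilon> B T s Q \<longleftrightarrow> (fits B s \<longrightarrow>
     (\<exists>t\<le>T. Q (run P \<epsilon> t s) \<and> (\<forall>k\<le>t. fits B (run P \<epsilon> k s))))"

lemma run_0 [simp]: "run P \<epsilon> 0 s = s"
  by (simp add: run_def)

lemma run_Suc: "run P \<epsilon> (Suc t) s = run P \<epsilon> t (step P \<epsilon> s)"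
  by (simp add: run_def funpow_swap1)

lemma run_add: "run P \<epsilon> (t + u) s = run P \<epsilon> u (run P \<epsilon> t s)"
  by (simp add: run_def add.commute[of t u] funpow_add)

lemma reaches_refl: "Q s \<Longrightarrow> reaches P \<epsilon> B T s Q"
  by (auto simp: reaches_def intro!: exI[of _ 0])

lemma reaches_trans:
  assumes "reaches P \<epsilon> B T s Q" "\<And>s'. Q s' \<Longrightarrow> fits B s' \<Longrightarrow> reaches P \<epsilon> B U s' Q'"
  shows "reaches P \<epsilon> B (T + U) s Q'"
  unfolding reaches_def
proof
  assume "fits B s"
  then obtain t where t: "t \<le> T" "Q (run P \<epsilon> t s)" "\<And>k. k \<le> t \<Longrightarrow> fits B (run P \<epsilon> k s)"
    using assms(1) by (auto simp: reaches_def)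
  then obtain u where u: "u \<le> U" "Q' (run P \<epsilon> u (run P \<epsilon> t s))"
    "\<And>k. k \<le> u \<Longrightarrow> fits B (run P \<epsilon> k (run P \<epsilon> t s))"
    using assms(2)[of "run P \<epsilon> t s"] by (auto simp: reaches_def)
  have "fits B (run P \<epsilon> k s)" if "k \<le> t + u" for k
  proof (cases "k \<le> t")
    case False
    then have "k = t + (k - t)" by simp
    then show ?thesis using u(3)[of "k - t"] that False by (metis diff_le_mono diff_add_inverse run_add)
  qed (use t in auto)
  then show "\<exists>t\<le>T + U. Q' (run P \<epsilon> t s) \<and> (\<forall>k\<le>t. fits B (run P \<epsilon> k s))"
    using t u by (intro exI[of _ "t + u"]) (auto simp: run_add)
qed

lemma reaches_mono:
  assumes "reaches P \<epsilon> B T s Q" "T \<le> U" "\<And>s'. Q s' \<Longrightarrow> Q' s'"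
  shows "reaches P \<epsilon> B U s Q'"
  unfolding reaches_def
proof
  assume "fits B s"
  then obtain t where "t \<le> T" "Q (run P \<epsilon> t s)" "\<forall>k\<le>t. fits B (run P \<epsilon> k s)"
    using assms(1) by (auto simp: reaches_def)
  then show "\<exists>t\<le>U. Q' (run P \<epsilon> t s) \<and> (\<forall>k\<le>t. fits B (run P \<epsilon> k s))"
    using assms(2,3) by (intro exI[of _ t]) auto
qed

text \<open>Subtraction, division and copying never exceed values that are already present, so only
  constants, sums and products need a check.\<close>

fun safe :: "nat \<Rightarrow> instr \<Rightarrow> (nat \<Rightarrow> nat) \<Rightarrow> bool" where
  "safe B (Const i k) r \<longleftrightarrow> k \<le> B"
| "safe B (Add i j k) r \<longleftrightarrow> r j + r k \<le> B"
| "safe B (Mul i j k) r \<longleftrightarrow> r j * r k \<le> B"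
| "safe B _ r \<longleftrightarrow> True"

lemma fits_exec: "fits B s \<Longrightarrow> safe B i (regs s) \<Longrightarrow> fits B (exec \<epsilon> i s)"
  by (cases i) (auto simp: fits_def set_reg_def branch_def intro: le_trans[OF diff_le_self] le_trans[OF div_le_dividend])

text \<open>The rule for symbolic execution. When it is repeated, \<open>T\<close> counts down and
  \<open>0 < T\<close> ends the repetition; therefore the straight-line segments below carry exact
  instruction counts, and a shorter branch is weakened afterwards.\<close>

lemma reaches_step:
  assumes "k < length P" "0 < T" "fits B (cfg k r m) \<Longrightarrow> safe B (P ! k) r"
    "reaches P \<epsilon> B (T - 1) (exec \<epsilon> (P ! k) (cfg k r m)) Q"
  shows "reaches P \<epsilon> B T (cfg k r m) Q"
proof -
  let ?s = "cfg k r m"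
  have run: "run P \<epsilon> (Suc t) ?s = run P \<epsilon> t (exec \<epsilon> (P ! k) ?s)" for t
    using assms(1) by (simp add: run_Suc step_def halted_def)
  have "reaches P \<epsilon> B 1 ?s (\<lambda>s. s = exec \<epsilon> (P ! k) ?s)"
    unfolding reaches_def
  proof
    assume "fits B ?s"
    then have "fits B (exec \<epsilon> (P ! k) ?s)" using fits_exec assms(3) by auto
    then show "\<exists>t\<le>1. run P \<epsilon> t ?s = exec \<epsilon> (P ! k) ?s \<and> (\<forall>k\<le>t. fits B (run P \<epsilon> k ?s))"
      using \<open>fits B ?s\<close> run[of 0] by (auto intro!: exI[of _ 1] simp: le_Suc_eq)
  qed
  then have "reaches P \<epsilon> B (1 + (T - 1)) ?s Q"
    by (rule reaches_trans) (use assms in auto)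
  then show ?thesis using assms(2) by simp
qed




section \<open>The program\<close>

text \<open>
  Registers: 0--2 result, 3 \<open>n\<close>, 4 and 5 the constants 1 and 2, 6 the scale \<open>S\<close>, 7 the budget,
  8 the base of the mark array, 9 the base of the stack, 10 the current root, 11 zero (never written),
  12 the stack pointer, 13 the remaining budget, 14 the end of the current list, 15 the position in it,
  16 the accumulated product, 17 the start of the list, 18 the returned value, 21 the current vertex,
  22 the power of 2 exceeding \<open>n / \<epsilon>\<close>; 19 and 20 are temporary. A mark is the stack
  pointer of the call that removed the vertex, or 1 for a former root, so that a call finds its own marks
  when it clears them. The numbers in the comments are the jump targets.
\<close>

definition prog :: "instr list" where
  "prog =
   [Const 4 1, Const 5 2, Load 3 11, Const 6 1024, Const 2 10, Const 7 56, Const 20 28, Const 22 1,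
    \<comment> \<open>8\<close> JumpEps 3 22 14, Add 22 22 22, Add 6 6 6, Add 2 2 4, Add 7 7 20, Jump 8,
    \<comment> \<open>14\<close> Add 19 3 3, Load 8 19, Sub 19 19 4, Load 19 19, Add 19 19 19, Add 8 8 19,
    Sub 1 8 4, Sub 1 1 3, Sub 1 1 3, Div 1 1 5, Div 1 1 5, Add 9 8 3, Add 0 6 11,
    \<comment> \<open>27\<close> JumpLess 10 3 29, Jump 97, Add 19 8 10, Store 19 4, Add 12 9 11, Add 21 10 11, Add 13 7 11,
    \<comment> \<open>34\<close> Add 19 21 21, Add 19 19 4, Load 14 19, Add 19 19 4, Load 15 19, JumpLess 13 14 74,
    Sub 13 13 14, Add 17 15 11, Add 14 14 14, Add 14 15 14, Add 16 6 11,
    \<comment> \<open>45\<close> JumpLess 15 14 56, Sub 18 6 16,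
    \<comment> \<open>47\<close> JumpLess 17 14 49, Jump 75, Load 19 17, Add 19 8 19, Load 20 19, JumpLess 20 12 54, Store 19 11,
    Add 17 17 5, Jump 47,
    \<comment> \<open>56\<close> Div 16 16 5, Load 21 15, Add 15 15 5, Add 19 8 21, Load 20 19, JumpLess 11 20 45, Store 19 12,
    Store 12 13, Add 12 12 4, Store 12 14, Add 12 12 4, Store 12 15, Add 12 12 4, Store 12 16,
    Add 12 12 4, Store 12 17, Add 12 12 4, Jump 34,
    \<comment> \<open>74\<close> Add 18 6 11,
    \<comment> \<open>75\<close> JumpLess 9 12 84, Mul 0 0 18, Div 0 0 6, JumpLess 0 6 80, Jump 82, Add 0 0 0, Add 2 2 4,
    Add 10 10 4, Jump 27,
    \<comment> \<open>84\<close> Sub 12 12 4, Load 17 12, Sub 12 12 4, Load 16 12, Sub 12 12 4, Load 15 12, Sub 12 12 4,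
    Load 14 12, Sub 12 12 4, Load 13 12, Mul 16 16 6, Div 16 16 18, Jump 45]"

lemma length_prog: "length prog = 97"
  by (simp add: prog_def)

lemma prog_nth:
  "prog ! 0 = Const 4 1" "prog ! Suc 0 = Const 5 2" "prog ! 2 = Load 3 11" "prog ! 3 = Const 6 1024"
  "prog ! 4 = Const 2 10" "prog ! 5 = Const 7 56" "prog ! 6 = Const 20 28" "prog ! 7 = Const 22 1"
  "prog ! 8 = JumpEps 3 22 14" "prog ! 9 = Add 22 22 22" "prog ! 10 = Add 6 6 6" "prog ! 11 = Add 2 2 4"
  "prog ! 12 = Add 7 7 20" "prog ! 13 = Jump 8"
  "prog ! 14 = Add 19 3 3" "prog ! 15 = Load 8 19" "prog ! 16 = Sub 19 19 4" "prog ! 17 = Load 19 19"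
  "prog ! 18 = Add 19 19 19" "prog ! 19 = Add 8 8 19" "prog ! 20 = Sub 1 8 4" "prog ! 21 = Sub 1 1 3"
  "prog ! 22 = Sub 1 1 3" "prog ! 23 = Div 1 1 5" "prog ! 24 = Div 1 1 5" "prog ! 25 = Add 9 8 3"
  "prog ! 26 = Add 0 6 11"
  "prog ! 27 = JumpLess 10 3 29" "prog ! 28 = Jump 97" "prog ! 29 = Add 19 8 10" "prog ! 30 = Store 19 4"
  "prog ! 31 = Add 12 9 11" "prog ! 32 = Add 21 10 11" "prog ! 33 = Add 13 7 11"
  "prog ! 34 = Add 19 21 21" "prog ! 35 = Add 19 19 4" "prog ! 36 = Load 14 19" "prog ! 37 = Add 19 19 4"
  "prog ! 38 = Load 15 19" "prog ! 39 = JumpLess 13 14 74" "prog ! 40 = Sub 13 13 14"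
  "prog ! 41 = Add 17 15 11" "prog ! 42 = Add 14 14 14" "prog ! 43 = Add 14 15 14" "prog ! 44 = Add 16 6 11"
  "prog ! 45 = JumpLess 15 14 56" "prog ! 46 = Sub 18 6 16"
  "prog ! 47 = JumpLess 17 14 49" "prog ! 48 = Jump 75" "prog ! 49 = Load 19 17" "prog ! 50 = Add 19 8 19"
  "prog ! 51 = Load 20 19" "prog ! 52 = JumpLess 20 12 54" "prog ! 53 = Store 19 11"
  "prog ! 54 = Add 17 17 5" "prog ! 55 = Jump 47"
  "prog ! 56 = Div 16 16 5" "prog ! 57 = Load 21 15" "prog ! 58 = Add 15 15 5" "prog ! 59 = Add 19 8 21"
  "prog ! 60 = Load 20 19" "prog ! 61 = JumpLess 11 20 45" "prog ! 62 = Store 19 12"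
  "prog ! 63 = Store 12 13" "prog ! 64 = Add 12 12 4" "prog ! 65 = Store 12 14" "prog ! 66 = Add 12 12 4"
  "prog ! 67 = Store 12 15" "prog ! 68 = Add 12 12 4" "prog ! 69 = Store 12 16" "prog ! 70 = Add 12 12 4"
  "prog ! 71 = Store 12 17" "prog ! 72 = Add 12 12 4" "prog ! 73 = Jump 34"
  "prog ! 74 = Add 18 6 11"
  "prog ! 75 = JumpLess 9 12 84" "prog ! 76 = Mul 0 0 18" "prog ! 77 = Div 0 0 6" "prog ! 78 = JumpLess 0 6 80"
  "prog ! 79 = Jump 82" "prog ! 80 = Add 0 0 0" "prog ! 81 = Add 2 2 4" "prog ! 82 = Add 10 10 4"
  "prog ! 83 = Jump 27"
  "prog ! 84 = Sub 12 12 4" "prog ! 85 = Load 17 12" "prog ! 86 = Sub 12 12 4" "prog ! 87 = Load 16 12"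
  "prog ! 88 = Sub 12 12 4" "prog ! 89 = Load 15 12" "prog ! 90 = Sub 12 12 4" "prog ! 91 = Load 14 12"
  "prog ! 92 = Sub 12 12 4" "prog ! 93 = Load 13 12" "prog ! 94 = Mul 16 16 6" "prog ! 95 = Div 16 16 18"
  "prog ! 96 = Jump 45"
  by (simp_all add: prog_def)

declare length_prog [simp] prog_nth [simp] set_reg_def [simp] branch_def [simp]

text \<open>Registers below 12 belong to the outer loop (result, constants, bases, current root); a
  recursive call works only with the others.\<close>

definition keep :: "(nat \<Rightarrow> nat) \<Rightarrow> (nat \<Rightarrow> nat) \<Rightarrow> bool" where
  "keep r r' \<longleftrightarrow> (\<forall>i<12. r' i = r i)"

lemma keep_trans: "keep r r' \<Longrightarrow> keep r' r'' \<Longrightarrow> keep r r''"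
  by (simp add: keep_def)

text \<open>All that execution needs to know about the graph. \<open>MB\<close> is the end of the
  input and the base of the marks. \<open>marginal_ge\<close> is the only numerical fact: it keeps
  the accumulated product from growing. The largest value computed is a mantissa of at most
  \<open>2 * S\<close> times a ratio of at most \<open>S\<close>, whence the bound on
  \<open>2 * (S * S)\<close>.\<close>

locale machine =
  fixes nb :: "nat \<Rightarrow> nat list" and start :: "nat \<Rightarrow> nat" and n S MB B :: nat and \<epsilon> :: real
  assumes nb_less: "v < n \<Longrightarrow> u \<in> set (nb v) \<Longrightarrow> u < n"
    and nb_length: "v < n \<Longrightarrow> 3 \<le> length (nb v)"
    and start: "v < n \<Longrightarrow> 2 * n < start v \<and> start v + 2 * length (nb v) \<le> MB"
    and MB: "2 * n < MB" "MB + n \<le> B"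
    and marginal_ge: "u < n \<Longrightarrow> u \<in> R \<Longrightarrow> S \<le> 2 * marginal S nb b R u"
    and S: "0 < S" "2 * (S * S) \<le> B"
begin

definition consts_ok :: "(nat \<Rightarrow> nat) \<Rightarrow> bool" where
  "consts_ok r \<longleftrightarrow> r 3 = n \<and> r 4 = 1 \<and> r 5 = 2 \<and> r 6 = S \<and> r 8 = MB \<and> r 9 = MB + n \<and> r 11 = 0"

lemma consts_ok_keep: "consts_ok r \<Longrightarrow> keep r r' \<Longrightarrow> consts_ok r'"
  by (simp add: consts_ok_def keep_def)

definition input_ok :: "(nat \<Rightarrow> nat) \<Rightarrow> bool" where
  "input_ok m \<longleftrightarrow> (\<forall>v<n. m (2 * v + 1) = length (nb v) \<and> m (2 * v + 2) = start v \<and>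
     (\<forall>j<length (nb v). m (start v + 2 * j) = nb v ! j))"

lemma S_le_B: "S \<le> B" 
proof -
  have "S \<le> S * S" by simp
  then show ?thesis using S(2) by linarith
qed

section \<open>Straight-line segments of a recursive call\<close>

lemma enter:
  assumes r: "consts_ok r" and m: "input_ok m" and v: "r 21 = v" "v < n"
    and b: "length (nb v) \<le> r 13"
    and post: "\<And>r'. keep r r' \<Longrightarrow> r' 12 = r 12 \<Longrightarrow> r' 13 = r 13 - length (nb v) \<Longrightarrow>
      r' 14 = start v + 2 * length (nb v) \<Longrightarrow> r' 15 = start v \<Longrightarrow> r' 16 = S \<Longrightarrow> r' 17 = start v \<Longrightarrow>
      Q (cfg 45 r' m)"
  shows "reaches prog \<epsilon> B 11 (cfg 34 r m) Q"
proof -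
  have mv: "m (Suc (v + v)) = length (nb v)" "m (Suc (Suc (v + v))) = start v"
    using m v by (auto simp: input_ok_def mult_2)
  have le: "Suc (Suc (v + v)) \<le> B" "start v + (length (nb v) + length (nb v)) \<le> B" "S \<le> B"
    using start[OF v(2)] MB v(2) S_le_B by linarith+
  have le': "Suc (v + v) \<le> B" "v + v \<le> B" "start v \<le> B" "length (nb v) + length (nb v) \<le> B"
    "\<not> r 13 < length (nb v)"
    using le b by linarith+
  note [simp] = v(1) mv le le' r[unfolded consts_ok_def, simplified]
  show ?thesis
    apply (rule reaches_step, simp, simp, simp, simp)+
    apply (rule reaches_refl, rule post)
    apply (simp_all add: keep_def)
    done
qed

lemma enter_leaf:
  assumes r: "consts_ok r" and m: "input_ok m" and v: "r 21 = v" "v < n"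
    and b: "r 13 < length (nb v)"
    and post: "\<And>r'. keep r r' \<Longrightarrow> r' 12 = r 12 \<Longrightarrow> r' 18 = S \<Longrightarrow> Q (cfg 75 r' m)"
  shows "reaches prog \<epsilon> B 7 (cfg 34 r m) Q"
proof -
  have mv: "m (Suc (v + v)) = length (nb v)" "m (Suc (Suc (v + v))) = start v"
    using m v by (auto simp: input_ok_def mult_2)
  have le: "Suc (Suc (v + v)) \<le> B" "S \<le> B"
    using start[OF v(2)] MB v(2) S_le_B by linarith+
  have le': "Suc (v + v) \<le> B" "v + v \<le> B" using le by linarith+
  note [simp] = v(1) mv le le' r[unfolded consts_ok_def, simplified] b
  show ?thesis
    apply (rule reaches_step, simp, simp, simp, simp)+
    apply (rule reaches_refl, rule post)
    apply (simp_all add: keep_def)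
    done
qed

lemma skip_entry:
  assumes r: "consts_ok r" and u: "m (r 15) = u" "u < n" and mu: "m (MB + u) > 0"
    and more: "r 15 < r 14" "r 15 + 2 \<le> MB"
    and post: "\<And>r'. keep r r' \<Longrightarrow> r' 12 = r 12 \<Longrightarrow> r' 13 = r 13 \<Longrightarrow> r' 14 = r 14 \<Longrightarrow>
      r' 15 = r 15 + 2 \<Longrightarrow> r' 16 = r 16 div 2 \<Longrightarrow> r' 17 = r 17 \<Longrightarrow> Q (cfg 45 r' m)"
  shows "reaches prog \<epsilon> B 7 (cfg 45 r m) Q"
proof -
  have le: "Suc (Suc (r 15)) \<le> B" "MB + u \<le> B" using more MB u by linarith+
  note [simp] = u(1) le r[unfolded consts_ok_def, simplified] more(1) mu
  show ?thesis
    apply (rule reaches_step, simp, simp, simp, simp)+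
    apply (rule reaches_refl, rule post)
    apply (simp_all add: keep_def)
    done
qed

lemma push:
  assumes r: "consts_ok r" and u: "m (r 15) = u" "u < n" and mu: "m (MB + u) = 0"
    and more: "r 15 < r 14" "r 15 + 2 \<le> MB" and sp: "r 12 + 5 \<le> B"
    and post: "\<And>r' m'. keep r r' \<Longrightarrow> r' 12 = r 12 + 5 \<Longrightarrow> r' 13 = r 13 \<Longrightarrow> r' 21 = u \<Longrightarrow>
      m' = m(MB + u := r 12, r 12 := r 13, r 12 + 1 := r 14, r 12 + 2 := r 15 + 2,
        r 12 + 3 := r 16 div 2, r 12 + 4 := r 17) \<Longrightarrow> Q (cfg 34 r' m')"
  shows "reaches prog \<epsilon> B 19 (cfg 45 r m) Q"
proof -
  have le: "Suc (Suc (r 15)) \<le> B" "MB + u \<le> B" using more MB u by linarith+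
  have le': "Suc (r 12) \<le> B" "Suc (Suc (r 12)) \<le> B" "Suc (Suc (Suc (r 12))) \<le> B"
    "Suc (Suc (Suc (Suc (r 12)))) \<le> B" "Suc (Suc (Suc (Suc (Suc (r 12))))) \<le> B" using sp by linarith+
  note [simp] = u(1) le le' r[unfolded consts_ok_def, simplified] more(1) mu
  show ?thesis
    apply (rule reaches_step, simp, simp, simp, simp)+
    apply (rule reaches_refl, rule post)
    apply (simp_all add: keep_def numeral_eq_Suc)
    done
qed

lemma pop:
  assumes r: "consts_ok r" and sp: "r 12 = sp + 5" "MB + n \<le> sp" and p: "m (sp + 3) \<le> S"
    and post: "\<And>r'. keep r r' \<Longrightarrow> r' 12 = sp \<Longrightarrow> r' 13 = m sp \<Longrightarrow> r' 14 = m (sp + 1) \<Longrightarrow>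
      r' 15 = m (sp + 2) \<Longrightarrow> r' 16 = m (sp + 3) * S div r 18 \<Longrightarrow> r' 17 = m (sp + 4) \<Longrightarrow> Q (cfg 45 r' m)"
  shows "reaches prog \<epsilon> B 14 (cfg 75 r m) Q"
proof -
  have "m (sp + 3) * S \<le> S * S" using p by simp
  then have "m (sp + 3) * S \<le> B" using S(2) by linarith
  then have le: "m (Suc (Suc (Suc sp))) * S \<le> B" by (simp add: numeral_3_eq_3)
  have sp': "r 12 = Suc (Suc (Suc (Suc (Suc sp))))" using sp by simp
  note [simp] = le sp' r[unfolded consts_ok_def, simplified]
  have [simp]: "MB + n < Suc (Suc (Suc (Suc (Suc sp))))" using sp by simp
  show ?thesis
    apply (rule reaches_step, simp, simp, simp, simp)+
    apply (rule reaches_refl, rule post)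
    apply (simp_all add: keep_def numeral_eq_Suc)
    done
qed

lemma unmark_entry:
  assumes r: "consts_ok r" and u: "m (r 17) = u" "u < n"
    and more: "r 17 < r 14" "r 17 + 2 \<le> MB"
    and post: "\<And>r'. keep r r' \<Longrightarrow> r' 12 = r 12 \<Longrightarrow> r' 14 = r 14 \<Longrightarrow> r' 18 = r 18 \<Longrightarrow> r' 17 = r 17 + 2 \<Longrightarrow>
      Q (cfg 47 r' (if m (MB + u) < r 12 then m else m(MB + u := 0)))"
  shows "reaches prog \<epsilon> B 8 (cfg 47 r m) Q"
proof -
  have le: "Suc (Suc (r 17)) \<le> B" "MB + u \<le> B" using more MB u by linarith+
  note [simp] = u(1) le r[unfolded consts_ok_def, simplified] more(1)
  show ?thesis
  proof (cases "m (MB + u) < r 12")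
    case True
    note [simp] = True
    have "reaches prog \<epsilon> B 7 (cfg 47 r m) Q"
      apply (rule reaches_step, simp, simp, simp, simp)+
      apply (rule reaches_refl)
      subgoal premises using post[of "r(19 := MB + u, 20 := m (MB + u), 17 := Suc (Suc (r 17)))"]
        by (simp add: keep_def fun_upd_twist)
      done
    then show ?thesis by (rule reaches_mono) auto
  next
    case False
    note [simp] = False
    show ?thesis
      apply (rule reaches_step, simp, simp, simp, simp)+
      apply (rule reaches_refl)
      subgoal premises using post[of "r(19 := MB + u, 20 := m (MB + u), 17 := Suc (Suc (r 17)))"]
        by (simp add: keep_def fun_upd_twist)
      done
  qed
qed

lemma unmark_exit:
  assumes "r 17 = r 14" "Q (cfg 75 r m)"
  shows "reaches prog \<epsilon> B 2 (cfg 47 r m) Q"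
  using assms
  apply -
  apply (rule reaches_step, simp, simp, simp, simp)+
  apply (rule reaches_refl, simp)
  done

lemma list_exit:
  assumes r: "consts_ok r" and "r 15 = r 14"
    and post: "\<And>r'. keep r r' \<Longrightarrow> r' 12 = r 12 \<Longrightarrow> r' 14 = r 14 \<Longrightarrow> r' 17 = r 17 \<Longrightarrow>
      r' 18 = S - r 16 \<Longrightarrow> Q (cfg 47 r' m)"
  shows "reaches prog \<epsilon> B 2 (cfg 45 r m) Q"
proof -
  note [simp] = assms(2) r[unfolded consts_ok_def, simplified]
  show ?thesis
    apply (rule reaches_step, simp, simp, simp, simp)+
    apply (rule reaches_refl, rule post)
    apply (simp_all add: keep_def)
    done
qed

section \<open>Loop invariants and the recursive call\<close>

lemma input_ok_cong: "input_ok m \<Longrightarrow> (\<And>a. a < MB \<Longrightarrow> m' a = m a) \<Longrightarrow> input_ok m'"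
  unfolding input_ok_def
proof (intro allI impI conjI)
  fix v assume m: "\<forall>v<n. m (2 * v + 1) = length (nb v) \<and> m (2 * v + 2) = start v \<and>
    (\<forall>j<length (nb v). m (start v + 2 * j) = nb v ! j)" and eq: "\<And>a. a < MB \<Longrightarrow> m' a = m a" and v: "v < n"
  have "2 * v + 1 < MB" "2 * v + 2 < MB" using MB v by linarith+
  then show "m' (2 * v + 1) = length (nb v)" "m' (2 * v + 2) = start v" using eq m v by simp_all
  fix j assume "j < length (nb v)"
  moreover from this have "start v + 2 * j < MB" using start[OF v] by linarith
  ultimately show "m' (start v + 2 * j) = nb v ! j" using eq m v by simp
qed

text \<open>A recursive call is entered at 34 and returns at 75.\<close>

definition node_spec :: "nat \<Rightarrow> nat \<Rightarrow> bool" where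
  "node_spec b T \<longleftrightarrow> (\<forall>R v r m sp. consts_ok r \<longrightarrow> input_ok m \<longrightarrow> v < n \<longrightarrow> v \<in> R \<longrightarrow>
     r 21 = v \<longrightarrow> r 13 = b \<longrightarrow> r 12 = sp \<longrightarrow> MB + n \<le> sp \<longrightarrow> sp + 5 * b \<le> B \<longrightarrow>
     (\<forall>u<n. (u \<in> R \<longleftrightarrow> m (MB + u) > 0) \<and> m (MB + u) < sp) \<longrightarrow>
     reaches prog \<epsilon> B T (cfg 34 r m) (\<lambda>s. \<exists>r' m'. s = cfg 75 r' m' \<and> keep r r' \<and> r' 12 = sp \<and>
       r' 18 = marginal S nb b R v \<and> (\<forall>a<sp. m' a = m a)))"

text \<open>Dividing by a ratio of at least 1/2 at most doubles, which the preceding halving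
  compensates. So the product register never exceeds its initial value \<open>S\<close>.\<close>

lemma update_le:
  assumes "u < n" "u \<in> R"
  shows "p div 2 * S div marginal S nb b R u \<le> p"
proof -
  let ?F = "marginal S nb b R u"
  have "p div 2 * S \<le> p div 2 * (2 * ?F)" using marginal_ge[OF assms] by (intro mult_le_mono) auto
  also have "\<dots> = (p div 2 * 2) * ?F" by simp
  also have "\<dots> \<le> p * ?F" by (intro mult_le_mono) auto
  finally have "p div 2 * S div ?F \<le> p * ?F div ?F" by (rule div_le_mono)
  also have "\<dots> \<le> p" by simp
  finally show ?thesis .
qed

text \<open>During the loop marks may equal \<open>sp\<close>, the mark of this call itself. A child
  runs with stack pointer \<open>sp + 5\<close>, so all marks it finds are strictly smaller, as
  \<open>node_spec\<close> demands, and it leaves everything below \<open>sp + 5\<close> as it was.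
  The positive marks are always the removed set, which grows along the list. The 33 instructions per
  entry are 19 for pushing and 14 for popping.\<close>

lemma list_loop:
  assumes spec: "node_spec b T" and v: "v < n"
    and "nb v = ys @ xs" "consts_ok r" "input_ok m" "r 12 = sp" "r 13 = b"
    "r 14 = start v + 2 * length (nb v)" "r 15 = start v + 2 * length ys" "r 16 = p" "p \<le> S" "r 17 = start v"
    "\<And>u. u < n \<Longrightarrow> (u \<in> R \<longleftrightarrow> m (MB + u) > 0) \<and> m (MB + u) \<le> sp"
    and sp: "MB + n \<le> sp" "sp + 5 + 5 * b \<le> B"
  shows "reaches prog \<epsilon> B (length xs * (T + 33)) (cfg 45 r m) (\<lambda>s. \<exists>r' m'. s = cfg 45 r' m' \<and> keep r r' \<and>
    r' 12 = sp \<and> r' 14 = r 14 \<and> r' 15 = r 14 \<and> r' 16 = blocked S nb b R xs p \<and> r' 17 = start v \<and>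
    (\<forall>a<sp. \<not> (MB \<le> a \<and> a < MB + n) \<longrightarrow> m' a = m a) \<and>
    (\<forall>u<n. m' (MB + u) = (if u \<in> R then m (MB + u) else if u \<in> set xs then sp else 0)))"
  using assms(3-13)
proof (induction xs arbitrary: ys r m p R)
  case Nil
  then show ?case
    by - (rule reaches_refl, rule exI[of _ r], rule exI[of _ m], auto simp: keep_def)
next
  case (Cons u xs)
  note P = Cons.prems
  have u: "u < n" using nb_less[OF v] P(1) by simp
  have j: "length ys < length (nb v)" "nb v ! length ys = u" using P(1) by auto
  have mu: "m (r 15) = u" using P(3) v j unfolding input_ok_def P(7) by auto
  have more: "r 15 < r 14" "r 15 + 2 \<le> MB" using start[OF v] j P(6,7) by linarith+
  have nb': "nb v = (ys @ [u]) @ xs" using P(1) by simp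
  show ?case
  proof (cases "u \<in> R")
    case True
    then have "m (MB + u) > 0" using P(11)[OF u] by simp
    have "reaches prog \<epsilon> B (7 + length xs * (T + 33)) (cfg 45 r m) (\<lambda>s. \<exists>r' m'. s = cfg 45 r' m' \<and> keep r r' \<and>
      r' 12 = sp \<and> r' 14 = r 14 \<and> r' 15 = r 14 \<and> r' 16 = blocked S nb b R xs (p div 2) \<and> r' 17 = start v \<and>
      (\<forall>a<sp. \<not> (MB \<le> a \<and> a < MB + n) \<longrightarrow> m' a = m a) \<and>
      (\<forall>u<n. m' (MB + u) = (if u \<in> R then m (MB + u) else if u \<in> set xs then sp else 0)))"
    proof (rule reaches_trans[where Q = "\<lambda>s. \<exists>r'. s = cfg 45 r' m \<and> keep r r' \<and> r' 12 = r 12 \<and> r' 13 = r 13 \<and>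
        r' 14 = r 14 \<and> r' 15 = r 15 + 2 \<and> r' 16 = r 16 div 2 \<and> r' 17 = r 17"])
      show "reaches prog \<epsilon> B 7 (cfg 45 r m) (\<lambda>s. \<exists>r'. s = cfg 45 r' m \<and> keep r r' \<and> r' 12 = r 12 \<and> r' 13 = r 13 \<and>
        r' 14 = r 14 \<and> r' 15 = r 15 + 2 \<and> r' 16 = r 16 div 2 \<and> r' 17 = r 17)"
        by (rule skip_entry[OF P(2) mu u \<open>m (MB + u) > 0\<close> more]) auto
    next
      fix s assume "\<exists>r'. s = cfg 45 r' m \<and> keep r r' \<and> r' 12 = r 12 \<and> r' 13 = r 13 \<and>
        r' 14 = r 14 \<and> r' 15 = r 15 + 2 \<and> r' 16 = r 16 div 2 \<and> r' 17 = r 17"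
      then obtain r1 where r1: "s = cfg 45 r1 m" "keep r r1" "r1 12 = r 12" "r1 13 = r 13"
        "r1 14 = r 14" "r1 15 = r 15 + 2" "r1 16 = r 16 div 2" "r1 17 = r 17" by blast
      have "reaches prog \<epsilon> B (length xs * (T + 33)) s (\<lambda>s. \<exists>r' m'. s = cfg 45 r' m' \<and> keep r1 r' \<and>
        r' 12 = sp \<and> r' 14 = r1 14 \<and> r' 15 = r1 14 \<and> r' 16 = blocked S nb b R xs (p div 2) \<and> r' 17 = start v \<and>
        (\<forall>a<sp. \<not> (MB \<le> a \<and> a < MB + n) \<longrightarrow> m' a = m a) \<and>
        (\<forall>u<n. m' (MB + u) = (if u \<in> R then m (MB + u) else if u \<in> set xs then sp else 0)))"
        unfolding r1(1) using P r1 consts_ok_keep[OF P(2) r1(2)] by (intro Cons.IH[OF nb']) auto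
      then show "reaches prog \<epsilon> B (length xs * (T + 33)) s (\<lambda>s. \<exists>r' m'. s = cfg 45 r' m' \<and> keep r r' \<and>
        r' 12 = sp \<and> r' 14 = r 14 \<and> r' 15 = r 14 \<and> r' 16 = blocked S nb b R xs (p div 2) \<and> r' 17 = start v \<and>
        (\<forall>a<sp. \<not> (MB \<le> a \<and> a < MB + n) \<longrightarrow> m' a = m a) \<and>
        (\<forall>u<n. m' (MB + u) = (if u \<in> R then m (MB + u) else if u \<in> set xs then sp else 0)))"
        by (rule reaches_mono) (use r1 keep_trans[OF r1(2)] in auto)
    qed
    then show ?thesis by (rule reaches_mono) (use True in auto)
  next
    case False
    then have mu0: "m (MB + u) = 0" using P(11)[OF u] by simp
    let ?R = "insert u R"
    let ?F = "marginal S nb b ?R u"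
    let ?p = "p div 2 * S div ?F"
    define m1 where "m1 = m(MB + u := sp, sp := b, sp + 1 := r 14, sp + 2 := r 15 + 2,
        sp + 3 := p div 2, sp + 4 := start v)"
    have m1_below: "m1 a = (if a = MB + u then sp else m a)" if "a < sp" for a
      using that by (simp add: m1_def)
    have m1_stack: "m1 sp = b" "m1 (sp + 1) = r 14" "m1 (sp + 2) = r 15 + 2" "m1 (sp + 3) = p div 2"
      "m1 (sp + 4) = start v" by (simp_all add: m1_def)
    have m1_in: "input_ok m1" using P(3) by (rule input_ok_cong) (use m1_below sp in auto)
    have m1_marks: "\<forall>w<n. (w \<in> ?R \<longleftrightarrow> m1 (MB + w) > 0) \<and> m1 (MB + w) < sp + 5"
    proof (intro allI impI)
      fix w assume w: "w < n"
      then have "MB + w < sp" using sp by simp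
      then show "(w \<in> ?R \<longleftrightarrow> m1 (MB + w) > 0) \<and> m1 (MB + w) < sp + 5"
        using m1_below[of "MB + w"] P(11)[OF w] sp MB by auto
    qed
    let ?Q1 = "\<lambda>s. \<exists>r'. s = cfg 34 r' m1 \<and> keep r r' \<and> r' 12 = sp + 5 \<and> r' 13 = b \<and> r' 21 = u"
    let ?Q2 = "\<lambda>s. \<exists>r' m'. s = cfg 75 r' m' \<and> keep r r' \<and> r' 12 = sp + 5 \<and> r' 18 = ?F \<and> (\<forall>a<sp + 5. m' a = m1 a)"
    let ?Q3 = "\<lambda>s. \<exists>r' m'. s = cfg 45 r' m' \<and> keep r r' \<and> r' 12 = sp \<and> r' 13 = b \<and> r' 14 = r 14 \<and>
      r' 15 = r 15 + 2 \<and> r' 16 = ?p \<and> r' 17 = start v \<and> (\<forall>a<sp + 5. m' a = m1 a)"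
    let ?Q4 = "\<lambda>s. \<exists>r' m'. s = cfg 45 r' m' \<and> keep r r' \<and>
      r' 12 = sp \<and> r' 14 = r 14 \<and> r' 15 = r 14 \<and> r' 16 = blocked S nb b ?R xs ?p \<and> r' 17 = start v \<and>
      (\<forall>a<sp. \<not> (MB \<le> a \<and> a < MB + n) \<longrightarrow> m' a = m a) \<and>
      (\<forall>w<n. m' (MB + w) = (if w \<in> R then m (MB + w) else if w \<in> set (u # xs) then sp else 0))"
    have 1: "reaches prog \<epsilon> B 19 (cfg 45 r m) ?Q1"
      by (rule push[OF P(2) mu u mu0 more]) (use sp P in \<open>auto simp: m1_def\<close>)
    have 2: "reaches prog \<epsilon> B T s ?Q2" if s: "?Q1 s" for s
    proof -
      obtain r1 where r1: "s = cfg 34 r1 m1" "keep r r1" "r1 12 = sp + 5" "r1 13 = b" "r1 21 = u"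
        using s by blast
      have "reaches prog \<epsilon> B T s (\<lambda>s. \<exists>r' m'. s = cfg 75 r' m' \<and> keep r1 r' \<and> r' 12 = sp + 5 \<and> r' 18 = ?F \<and> (\<forall>a<sp + 5. m' a = m1 a))"
        unfolding r1(1)
        by (rule spec[unfolded node_spec_def, rule_format, of r1 m1 u ?R "sp + 5"])
          (use r1 sp u m1_in m1_marks consts_ok_keep[OF P(2) r1(2)] in auto)
      then show ?thesis by (rule reaches_mono) (use keep_trans[OF r1(2)] in auto)
    qed
    have 3: "reaches prog \<epsilon> B 14 s ?Q3" if s: "?Q2 s" for s
    proof -
      obtain r2 m2 where r2: "s = cfg 75 r2 m2" "keep r r2" "r2 12 = sp + 5" "r2 18 = ?F" "\<And>a. a < sp + 5 \<Longrightarrow> m2 a = m1 a"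
        using s by blast
      have m2: "m2 sp = b" "m2 (sp + 1) = r 14" "m2 (sp + 2) = r 15 + 2" "m2 (sp + 3) = p div 2"
        "m2 (sp + 4) = start v" unfolding m1_stack[symmetric] by (rule r2(5); simp)+
      show ?thesis unfolding r2(1)
      proof (rule pop[OF consts_ok_keep[OF P(2) r2(2)] r2(3) sp(1)])
        show "m2 (sp + 3) \<le> S" using m2 P(9) by simp
        fix r' assume "keep r2 r'" "r' 12 = sp" "r' 13 = m2 sp" "r' 14 = m2 (sp + 1)" "r' 15 = m2 (sp + 2)"
          "r' 16 = m2 (sp + 3) * S div r2 18" "r' 17 = m2 (sp + 4)"
        then show "?Q3 (cfg 45 r' m2)"
          using keep_trans[OF r2(2)] r2(4,5) unfolding m2 by auto
      qed
    qed
    have 4: "reaches prog \<epsilon> B (length xs * (T + 33)) s ?Q4" if s: "?Q3 s" for s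
    proof -
      obtain r3 m3 where r3: "s = cfg 45 r3 m3" "keep r r3" "r3 12 = sp" "r3 13 = b" "r3 14 = r 14"
        "r3 15 = r 15 + 2" "r3 16 = ?p" "r3 17 = start v" "\<And>a. a < sp + 5 \<Longrightarrow> m3 a = m1 a"
        using s by blast
      have m3: "m3 a = (if a = MB + u then sp else m a)" if "a < sp" for a
        using r3(9)[of a] m1_below[of a] that by simp
      have m3_in: "input_ok m3" using P(3) by (rule input_ok_cong) (use m3 sp in auto)
      have m3_marks: "m3 (MB + w) = (if w = u then sp else m (MB + w))" if "w < n" for w
        using m3[of "MB + w"] that sp by simp
      have "reaches prog \<epsilon> B (length xs * (T + 33)) s (\<lambda>s. \<exists>r' m'. s = cfg 45 r' m' \<and> keep r3 r' \<and>
        r' 12 = sp \<and> r' 14 = r3 14 \<and> r' 15 = r3 14 \<and> r' 16 = blocked S nb b ?R xs ?p \<and> r' 17 = start v \<and>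
        (\<forall>a<sp. \<not> (MB \<le> a \<and> a < MB + n) \<longrightarrow> m' a = m3 a) \<and>
        (\<forall>w<n. m' (MB + w) = (if w \<in> ?R then m3 (MB + w) else if w \<in> set xs then sp else 0)))"
        unfolding r3(1)
      proof (rule Cons.IH[OF nb'])
        fix w assume w: "w < n"
        show "(w \<in> ?R) = (0 < m3 (MB + w)) \<and> m3 (MB + w) \<le> sp"
          using m3_marks[OF w] P(11)[OF w] sp MB by auto
      next
        show "?p \<le> S" using update_le[OF u, of ?R p b] P(9) by simp
      qed (use P r3 m3_in consts_ok_keep[OF P(2) r3(2)] in auto)
      then show ?thesis
      proof (rule reaches_mono)
        fix s' assume "\<exists>r' m'. s' = cfg 45 r' m' \<and> keep r3 r' \<and>
          r' 12 = sp \<and> r' 14 = r3 14 \<and> r' 15 = r3 14 \<and> r' 16 = blocked S nb b ?R xs ?p \<and> r' 17 = start v \<and>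
          (\<forall>a<sp. \<not> (MB \<le> a \<and> a < MB + n) \<longrightarrow> m' a = m3 a) \<and>
          (\<forall>w<n. m' (MB + w) = (if w \<in> ?R then m3 (MB + w) else if w \<in> set xs then sp else 0))"
        then obtain r' m' where *: "s' = cfg 45 r' m'" "keep r3 r'" "r' 12 = sp" "r' 14 = r3 14" "r' 15 = r3 14"
          "r' 16 = blocked S nb b ?R xs ?p" "r' 17 = start v"
          "\<And>a. a < sp \<Longrightarrow> \<not> (MB \<le> a \<and> a < MB + n) \<Longrightarrow> m' a = m3 a"
          "\<And>w. w < n \<Longrightarrow> m' (MB + w) = (if w \<in> ?R then m3 (MB + w) else if w \<in> set xs then sp else 0)"
          by blast
        have "m' a = m a" if "a < sp" "\<not> (MB \<le> a \<and> a < MB + n)" for a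
          using *(8)[OF that] m3[of a] that u by auto
        moreover have "m' (MB + w) = (if w \<in> R then m (MB + w) else if w \<in> set (u # xs) then sp else 0)" if "w < n" for w
          using *(9)[OF that] m3_marks[OF that] False by auto
        ultimately show "?Q4 s'"
          using *(1-7) keep_trans[OF r3(2) *(2)] r3(5) by - (rule exI[of _ r'], rule exI[of _ m'], auto)
      qed simp
    qed
    have "reaches prog \<epsilon> B (19 + (T + (14 + length xs * (T + 33)))) (cfg 45 r m) ?Q4"
      by (rule reaches_trans[OF 1 reaches_trans[OF 2 reaches_trans[OF 3 4]]])
    then show ?thesis by (rule reaches_mono) (use False in auto)
  qed
qed

text \<open>All vertices removed by a call are in its own list, so a second scan finds them. Marks
  of enclosing calls are smaller than \<open>sp\<close> and survive; a repeated entry meets the mark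
  0, which is also smaller since \<open>sp\<close> is positive.\<close>

lemma unmark_loop:
  assumes v: "v < n"
    and "nb v = ys @ xs" "consts_ok r" "input_ok m" "r 12 = sp"
    "r 14 = start v + 2 * length (nb v)" "r 17 = start v + 2 * length ys"
    and sp: "0 < sp"
  shows "reaches prog \<epsilon> B (length xs * 8) (cfg 47 r m) (\<lambda>s. \<exists>r' m'. s = cfg 47 r' m' \<and> keep r r' \<and>
    r' 12 = sp \<and> r' 14 = r 14 \<and> r' 17 = r 14 \<and> r' 18 = r 18 \<and>
    (\<forall>a. \<not> (MB \<le> a \<and> a < MB + n) \<longrightarrow> m' a = m a) \<and>
    (\<forall>u<n. m' (MB + u) = (if u \<in> set xs \<and> sp \<le> m (MB + u) then 0 else m (MB + u))))"
  using assms(2-7)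
proof (induction xs arbitrary: ys r m)
  case Nil
  then show ?case
    by - (rule reaches_refl, rule exI[of _ r], rule exI[of _ m], auto simp: keep_def)
next
  case (Cons u xs)
  note P = Cons.prems
  have u: "u < n" using nb_less[OF v] P(1) by simp
  have j: "length ys < length (nb v)" "nb v ! length ys = u" using P(1) by auto
  have mu: "m (r 17) = u" using P(3) v j unfolding input_ok_def P(6) by auto
  have more: "r 17 < r 14" "r 17 + 2 \<le> MB" using start[OF v] j P(5,6) by linarith+
  have nb': "nb v = (ys @ [u]) @ xs" using P(1) by simp
  let ?m = "if m (MB + u) < r 12 then m else m(MB + u := 0)"
  let ?Q1 = "\<lambda>s. \<exists>r'. s = cfg 47 r' ?m \<and> keep r r' \<and> r' 12 = r 12 \<and> r' 14 = r 14 \<and> r' 18 = r 18 \<and> r' 17 = r 17 + 2"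
  have "reaches prog \<epsilon> B 8 (cfg 47 r m) ?Q1"
    by (rule unmark_entry[where m = m, OF P(2) mu u more]) auto
  then have "reaches prog \<epsilon> B (8 + length xs * 8) (cfg 47 r m) (\<lambda>s. \<exists>r' m'. s = cfg 47 r' m' \<and> keep r r' \<and>
    r' 12 = sp \<and> r' 14 = r 14 \<and> r' 17 = r 14 \<and> r' 18 = r 18 \<and>
    (\<forall>a. \<not> (MB \<le> a \<and> a < MB + n) \<longrightarrow> m' a = m a) \<and>
    (\<forall>w<n. m' (MB + w) = (if w \<in> set (u # xs) \<and> sp \<le> m (MB + w) then 0 else m (MB + w))))"
  proof (rule reaches_trans)
    fix s assume "?Q1 s"
    then obtain r1 where r1: "s = cfg 47 r1 ?m" "keep r r1" "r1 12 = r 12" "r1 14 = r 14" "r1 18 = r 18" "r1 17 = r 17 + 2"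
      by blast
    have m1: "input_ok ?m" using P(3) by (rule input_ok_cong) auto
    have "reaches prog \<epsilon> B (length xs * 8) s (\<lambda>s. \<exists>r' m'. s = cfg 47 r' m' \<and> keep r1 r' \<and>
      r' 12 = sp \<and> r' 14 = r1 14 \<and> r' 17 = r1 14 \<and> r' 18 = r1 18 \<and>
      (\<forall>a. \<not> (MB \<le> a \<and> a < MB + n) \<longrightarrow> m' a = ?m a) \<and>
      (\<forall>w<n. m' (MB + w) = (if w \<in> set xs \<and> sp \<le> ?m (MB + w) then 0 else ?m (MB + w))))"
      unfolding r1(1) by (rule Cons.IH[OF nb' consts_ok_keep[OF P(2) r1(2)] m1]) (use P r1 in auto)
    then show "reaches prog \<epsilon> B (length xs * 8) s (\<lambda>s. \<exists>r' m'. s = cfg 47 r' m' \<and> keep r r' \<and>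
      r' 12 = sp \<and> r' 14 = r 14 \<and> r' 17 = r 14 \<and> r' 18 = r 18 \<and>
      (\<forall>a. \<not> (MB \<le> a \<and> a < MB + n) \<longrightarrow> m' a = m a) \<and>
      (\<forall>w<n. m' (MB + w) = (if w \<in> set (u # xs) \<and> sp \<le> m (MB + w) then 0 else m (MB + w))))"
    proof (rule reaches_mono)
      fix s' assume "\<exists>r' m'. s' = cfg 47 r' m' \<and> keep r1 r' \<and>
        r' 12 = sp \<and> r' 14 = r1 14 \<and> r' 17 = r1 14 \<and> r' 18 = r1 18 \<and>
        (\<forall>a. \<not> (MB \<le> a \<and> a < MB + n) \<longrightarrow> m' a = ?m a) \<and>
        (\<forall>w<n. m' (MB + w) = (if w \<in> set xs \<and> sp \<le> ?m (MB + w) then 0 else ?m (MB + w)))"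
      then obtain r' m' where *: "s' = cfg 47 r' m'" "keep r1 r'" "r' 12 = sp" "r' 14 = r1 14" "r' 17 = r1 14" "r' 18 = r1 18"
        "\<And>a. \<not> (MB \<le> a \<and> a < MB + n) \<Longrightarrow> m' a = ?m a"
        "\<And>w. w < n \<Longrightarrow> m' (MB + w) = (if w \<in> set xs \<and> sp \<le> ?m (MB + w) then 0 else ?m (MB + w))" by blast
      have "m' a = m a" if "\<not> (MB \<le> a \<and> a < MB + n)" for a
        using *(7)[OF that] that u by auto
      moreover have "m' (MB + w) = (if w \<in> set (u # xs) \<and> sp \<le> m (MB + w) then 0 else m (MB + w))" if "w < n" for w
        using *(8)[OF that] P(4) sp by (auto split: if_splits)
      ultimately show "\<exists>r' m'. s' = cfg 47 r' m' \<and> keep r r' \<and>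
        r' 12 = sp \<and> r' 14 = r 14 \<and> r' 17 = r 14 \<and> r' 18 = r 18 \<and>
        (\<forall>a. \<not> (MB \<le> a \<and> a < MB + n) \<longrightarrow> m' a = m a) \<and>
        (\<forall>w<n. m' (MB + w) = (if w \<in> set (u # xs) \<and> sp \<le> m (MB + w) then 0 else m (MB + w)))"
        using *(1-6) keep_trans[OF r1(2) *(2)] r1 by - (rule exI[of _ r'], rule exI[of _ m'], auto)
    qed simp
  qed
  then show ?case by simp
qed

lemma node_correct: "node_spec b (64 * 2 ^ b)"
proof (induction b rule: less_induct)
  case (less b)
  show ?case
    unfolding node_spec_def
  proof (intro allI impI)
    fix R v r m sp
    assume A: "consts_ok r" "input_ok m" "v < n" "v \<in> R" "r 21 = v" "r 13 = b" "r 12 = sp"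
      "MB + n \<le> sp" "sp + 5 * b \<le> B"
      and marks: "\<forall>u<n. (u \<in> R \<longleftrightarrow> m (MB + u) > 0) \<and> m (MB + u) < sp"
    let ?d = "length (nb v)"
    let ?Q = "\<lambda>s. \<exists>r' m'. s = cfg 75 r' m' \<and> keep r r' \<and> r' 12 = sp \<and>
       r' 18 = marginal S nb b R v \<and> (\<forall>a<sp. m' a = m a)"
    have d: "3 \<le> ?d" "nb v \<noteq> []" using nb_length[OF A(3)] by auto
    show "reaches prog \<epsilon> B (64 * 2 ^ b) (cfg 34 r m) ?Q"
    proof (cases "b < ?d")
      case True
      have "reaches prog \<epsilon> B 7 (cfg 34 r m) ?Q"
        by (rule enter_leaf[OF A(1,2,5,3)]) (use True A in \<open>auto simp: marginal.simps\<close>)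
      moreover have "(1::nat) \<le> 2 ^ b" by simp
      then have "7 \<le> 64 * (2::nat) ^ b" by linarith
      ultimately show ?thesis by (rule reaches_mono)
    next
      case False
      let ?b = "b - ?d"
      let ?T = "64 * 2 ^ ?b"
      let ?B = "blocked S nb ?b R (nb v) S"
      have marg: "marginal S nb b R v = S - ?B" using False d by (simp add: marginal.simps)
      have spec: "node_spec ?b ?T" using less[of ?b] d False by auto
      let ?Q1 = "\<lambda>s. \<exists>r'. s = cfg 45 r' m \<and> keep r r' \<and> r' 12 = sp \<and> r' 13 = ?b \<and>
        r' 14 = start v + 2 * ?d \<and> r' 15 = start v \<and> r' 16 = S \<and> r' 17 = start v"
      let ?M = "\<lambda>m'. (\<forall>a<sp. \<not> (MB \<le> a \<and> a < MB + n) \<longrightarrow> m' a = m a) \<and>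
        (\<forall>u<n. m' (MB + u) = (if u \<in> R then m (MB + u) else if u \<in> set (nb v) then sp else 0))"
      let ?Q2 = "\<lambda>s. \<exists>r' m'. s = cfg 45 r' m' \<and> keep r r' \<and> r' 12 = sp \<and> r' 14 = start v + 2 * ?d \<and>
        r' 15 = start v + 2 * ?d \<and> r' 16 = ?B \<and> r' 17 = start v \<and> ?M m'"
      let ?Q3 = "\<lambda>s. \<exists>r' m'. s = cfg 47 r' m' \<and> keep r r' \<and> r' 12 = sp \<and> r' 14 = start v + 2 * ?d \<and>
        r' 17 = start v \<and> r' 18 = S - ?B \<and> ?M m'"
      let ?Q4 = "\<lambda>s. \<exists>r' m'. s = cfg 47 r' m' \<and> keep r r' \<and> r' 12 = sp \<and> r' 14 = r' 17 \<and> r' 18 = S - ?B \<and>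
        (\<forall>a<sp. m' a = m a)"
      have 1: "reaches prog \<epsilon> B 11 (cfg 34 r m) ?Q1"
        by (rule enter[OF A(1,2,5,3)]) (use False A in auto)
      have 2: "reaches prog \<epsilon> B (?d * (?T + 33)) s ?Q2" if s: "?Q1 s" for s
      proof -
        obtain r1 where r1: "s = cfg 45 r1 m" "keep r r1" "r1 12 = sp" "r1 13 = ?b"
          "r1 14 = start v + 2 * ?d" "r1 15 = start v" "r1 16 = S" "r1 17 = start v" using s by blast
        have "reaches prog \<epsilon> B (length (nb v) * (?T + 33)) s (\<lambda>s. \<exists>r' m'. s = cfg 45 r' m' \<and> keep r1 r' \<and>
          r' 12 = sp \<and> r' 14 = r1 14 \<and> r' 15 = r1 14 \<and> r' 16 = ?B \<and> r' 17 = start v \<and> ?M m')"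
          unfolding r1(1)
        proof (rule list_loop[OF spec A(3), of "[]"])
          \<comment> \<open>A level of the recursion takes five stack cells and at least three units
            of budget, so \<open>5 * b\<close> cells suffice.\<close>
          show "sp + 5 + 5 * ?b \<le> B" using A(9) False d by linarith
          show "(u \<in> R) = (0 < m (MB + u)) \<and> m (MB + u) \<le> sp" if "u < n" for u
            using marks that by auto
        qed (use r1 A consts_ok_keep[OF A(1) r1(2)] in auto)
        then show ?thesis
          by (rule reaches_mono) (use r1 keep_trans[OF r1(2)] in auto)
      qed
      have 3: "reaches prog \<epsilon> B 2 s ?Q3" if s: "?Q2 s" for s
      proof -
        obtain r1 m1 where r1: "s = cfg 45 r1 m1" "keep r r1" "r1 12 = sp" "r1 14 = start v + 2 * ?d"
          "r1 15 = start v + 2 * ?d" "r1 16 = ?B" "r1 17 = start v" "?M m1" using s by blast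
        show ?thesis unfolding r1(1)
        proof (rule list_exit[OF consts_ok_keep[OF A(1) r1(2)]])
          fix r' assume "keep r1 r'" "r' 12 = r1 12" "r' 14 = r1 14" "r' 17 = r1 17" "r' 18 = S - r1 16"
          then show "?Q3 (cfg 47 r' m1)"
            using r1 keep_trans[OF r1(2)] by - (rule exI[of _ r'], rule exI[of _ m1], auto)
        qed (use r1 in simp)
      qed
      have 4: "reaches prog \<epsilon> B (?d * 8) s ?Q4" if s: "?Q3 s" for s
      proof -
        obtain r1 m1 where r1: "s = cfg 47 r1 m1" "keep r r1" "r1 12 = sp" "r1 14 = start v + 2 * ?d"
          "r1 17 = start v" "r1 18 = S - ?B" 
          "\<And>a. a < sp \<Longrightarrow> \<not> (MB \<le> a \<and> a < MB + n) \<Longrightarrow> m1 a = m a"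
          "\<And>u. u < n \<Longrightarrow> m1 (MB + u) = (if u \<in> R then m (MB + u) else if u \<in> set (nb v) then sp else 0)"
          using s by blast
        have m1: "input_ok m1" using A(2) by (rule input_ok_cong) (use r1(7) A(8) in auto)
        have "reaches prog \<epsilon> B (?d * 8) s (\<lambda>s. \<exists>r' m'. s = cfg 47 r' m' \<and> keep r1 r' \<and>
          r' 12 = sp \<and> r' 14 = r1 14 \<and> r' 17 = r1 14 \<and> r' 18 = r1 18 \<and>
          (\<forall>a. \<not> (MB \<le> a \<and> a < MB + n) \<longrightarrow> m' a = m1 a) \<and>
          (\<forall>u<n. m' (MB + u) = (if u \<in> set (nb v) \<and> sp \<le> m1 (MB + u) then 0 else m1 (MB + u))))"
          unfolding r1(1)
          by (rule unmark_loop[OF A(3), of "[]"]) (use r1 A m1 MB consts_ok_keep[OF A(1) r1(2)] in auto)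
        then show ?thesis
        proof (rule reaches_mono)
          fix s' assume "\<exists>r' m'. s' = cfg 47 r' m' \<and> keep r1 r' \<and>
            r' 12 = sp \<and> r' 14 = r1 14 \<and> r' 17 = r1 14 \<and> r' 18 = r1 18 \<and>
            (\<forall>a. \<not> (MB \<le> a \<and> a < MB + n) \<longrightarrow> m' a = m1 a) \<and>
            (\<forall>u<n. m' (MB + u) = (if u \<in> set (nb v) \<and> sp \<le> m1 (MB + u) then 0 else m1 (MB + u)))"
          then obtain r' m' where *: "s' = cfg 47 r' m'" "keep r1 r'" "r' 12 = sp" "r' 14 = r1 14"
            "r' 17 = r1 14" "r' 18 = r1 18" "\<And>a. \<not> (MB \<le> a \<and> a < MB + n) \<Longrightarrow> m' a = m1 a"
            "\<And>u. u < n \<Longrightarrow> m' (MB + u) = (if u \<in> set (nb v) \<and> sp \<le> m1 (MB + u) then 0 else m1 (MB + u))"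
            by blast
          \<comment> \<open>A vertex of \<open>R\<close> keeps its mark, which is below
            \<open>sp\<close>. A vertex outside \<open>R\<close> had mark 0, may have received
            \<open>sp\<close> from this call, and is back at 0 after the second scan.\<close>
          have "m' a = m a" if a: "a < sp" for a
          proof (cases "MB \<le> a \<and> a < MB + n")
            case True
            then obtain u where u: "a = MB + u" "u < n" by (metis le_add_diff_inverse nat_add_left_cancel_less)
            have "(u \<in> R \<longleftrightarrow> m (MB + u) > 0) \<and> m (MB + u) < sp" using marks u by blast
            then show ?thesis unfolding u(1) using *(8)[OF u(2)] r1(8)[OF u(2)] by (auto split: if_splits)
          next
            case False
            then show ?thesis using *(7) r1(7) a by simp
          qed
          then show "?Q4 s'" using * keep_trans[OF r1(2) *(2)] r1 by - (rule exI[of _ r'], rule exI[of _ m'], auto)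
        qed simp
      qed
      have 5: "reaches prog \<epsilon> B 2 s ?Q" if s: "?Q4 s" for s
      proof -
        obtain r1 m1 where r1: "s = cfg 47 r1 m1" "keep r r1" "r1 12 = sp" "r1 14 = r1 17"
          "r1 18 = S - ?B" "\<forall>a<sp. m1 a = m a" using s by blast
        show ?thesis unfolding r1(1)
          by (rule unmark_exit) (use r1 marg in auto)
      qed
      have "reaches prog \<epsilon> B (11 + (?d * (?T + 33) + (2 + (?d * 8 + 2)))) (cfg 34 r m) ?Q"
        by (rule reaches_trans[OF 1 reaches_trans[OF 2 reaches_trans[OF 3 reaches_trans[OF 4 5]]]])
      \<comment> \<open>Of the \<open>2 * ?d + 2\<close> units granted by \<open>2 ^ ?d\<close>, the
        children take \<open>?d\<close>; the remaining \<open>?d + 2\<close>, multiplied by 64, pay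
        for the overhead \<open>41 * ?d + 15\<close>.\<close>
      moreover have "11 + (?d * (?T + 33) + (2 + (?d * 8 + 2))) \<le> 64 * 2 ^ b"
      proof -
        have two: "2 * k + 2 \<le> (2::nat) ^ k" if "3 \<le> k" for k
          using that by (induction k rule: nat_induct_at_least) auto
        define x where "x = (2::nat) ^ ?b"
        have "(?d + 2) * 1 \<le> (?d + 2) * x" by (intro mult_le_mono) (auto simp: x_def)
        moreover have "(2 * ?d + 2) * x \<le> 2 ^ ?d * x" using two d by (intro mult_le_mono) auto
        moreover have "2 ^ ?d * x = 2 ^ b" using False by (simp add: x_def flip: power_add)
        moreover have "?d * (64 * x + 33) = 64 * (?d * x) + 33 * ?d" by (simp add: algebra_simps)
        ultimately show ?thesis unfolding x_def[symmetric] using d by (simp add: algebra_simps)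
      qed
      ultimately show ?thesis by (rule reaches_mono) auto
    qed
  qed
qed

section \<open>Start and end of the evaluation at one root\<close>

lemma root_start:
  assumes r: "consts_ok r" and i: "r 10 = i" "i < n"
    and post: "\<And>r'. keep r r' \<Longrightarrow> r' 12 = MB + n \<Longrightarrow> r' 13 = r 7 \<Longrightarrow> r' 21 = i \<Longrightarrow>
      Q (cfg 34 r' (m(MB + i := 1)))"
    and b: "r 7 \<le> B"
  shows "reaches prog \<epsilon> B 6 (cfg 27 r m) Q"
proof -
  have le: "MB + i \<le> B" "i \<le> B" using i MB by linarith+
  note [simp] = le i b MB(2) r[unfolded consts_ok_def, simplified]
  show ?thesis
    apply (rule reaches_step, simp, simp, simp, simp)+
    apply (rule reaches_refl)
    subgoal premises using post[of "r(19 := MB + i, 12 := MB + n, 21 := i, 13 := r 7)"]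
      by (simp add: keep_def fun_upd_twist)
    done
qed

lemma root_finish:
  assumes r: "consts_ok r" and i: "r 10 = i" "i < n" and sp: "r 12 = MB + n"
    and a: "r 0 \<le> 2 * S" "r 18 \<le> S" and e: "r 2 < B"
    and post: "\<And>r'. (\<And>j. j < 12 \<Longrightarrow> j \<noteq> 0 \<Longrightarrow> j \<noteq> 2 \<Longrightarrow> j \<noteq> 10 \<Longrightarrow> r' j = r j) \<Longrightarrow> r' 10 = i + 1 \<Longrightarrow>
      r' 0 = (let a = r 0 * r 18 div S in if a < S then 2 * a else a) \<Longrightarrow>
      r' 2 = (if r 0 * r 18 div S < S then r 2 + 1 else r 2) \<Longrightarrow> Q (cfg 27 r' m)"
  shows "reaches prog \<epsilon> B 8 (cfg 75 r m) Q"
proof -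
  have "r 0 * r 18 \<le> 2 * S * S" using a by (intro mult_le_mono) auto
  then have le: "r 0 * r 18 \<le> B" "Suc i \<le> B" "Suc (r 2) \<le> B" "\<not> MB + n < MB + n" using S(2) i MB e by simp_all
  have small: "a + a \<le> B" if "a < S" for a
  proof -
    have "S \<le> S * S" by simp
    then show ?thesis using that S(2) by linarith
  qed
  note [simp] = le sp i(1) r[unfolded consts_ok_def, simplified]
  show ?thesis
  proof (cases "r 0 * r 18 div S < S")
    case True
    note [simp] = True small[OF True]
    show ?thesis
      apply (rule reaches_step, simp, simp, simp, simp)+
      apply (rule reaches_refl, rule post)
      apply (simp_all add: Let_def)
      done
  next
    case False
    note [simp] = False
    have "reaches prog \<epsilon> B 7 (cfg 75 r m) Q"
      apply (rule reaches_step, simp, simp, simp, simp)+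
      apply (rule reaches_refl, rule post)
      apply (simp_all add: Let_def)
      done
    then show ?thesis by (rule reaches_mono) auto
  qed
qed

end


section \<open>The outer loop\<close>

text \<open>A floating-point product of the ratios \<open>F j / S\<close>. The mantissa is kept
  between \<open>S\<close> and \<open>2 * S\<close>, so every rounding is relatively small however
  small the product becomes; one doubling restores this because the ratios are at least 1/2.\<close>

fun accum :: "nat \<Rightarrow> (nat \<Rightarrow> nat) \<Rightarrow> nat \<Rightarrow> nat \<times> nat" where
  "accum S F 0 = (S, 0)"
| "accum S F (Suc i) = (let a = fst (accum S F i) * F i div S; e = snd (accum S F i)
     in if a < S then (2 * a, Suc e) else (a, e))"

lemma accum_bounds:
  assumes "S > 0" "\<And>j. j < i \<Longrightarrow> F j \<le> S \<and> S \<le> 2 * F j"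
  shows "S \<le> fst (accum S F i) \<and> fst (accum S F i) \<le> 2 * S \<and> snd (accum S F i) \<le> i"
  using assms(2)
proof (induction i)
  case (Suc i)
  let ?a = "fst (accum S F i)"
  have IH: "S \<le> ?a" "?a \<le> 2 * S" "snd (accum S F i) \<le> i" using Suc by auto
  have F: "F i \<le> S" "S \<le> 2 * F i" using Suc by auto
  have "F i * S div S \<le> ?a * F i div S" using IH by (intro div_le_mono) simp
  then have 1: "F i \<le> ?a * F i div S" using assms(1) by simp
  have "?a * F i div S \<le> 2 * S * S div S" using IH F by (intro div_le_mono mult_le_mono)
  then have 2: "?a * F i div S \<le> 2 * S" using assms(1) by simp
  show ?case using 1 2 F IH by (auto simp: Let_def)
qed simp

lemma accum_value:
  assumes "S \<ge> 2" "\<And>j. j < i \<Longrightarrow> F j \<le> S \<and> S \<le> 2 * F j"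
  shows "(\<Prod>j<i. F j / S) * (1 - 2 / S) ^ i \<le> fst (accum S F i) / S / 2 ^ snd (accum S F i)
    \<and> fst (accum S F i) / S / 2 ^ snd (accum S F i) \<le> (\<Prod>j<i. F j / S)"
  using assms(2)
proof (induction i)
  case 0
  then show ?case using assms(1) by simp
next
  case (Suc i)
  let ?a = "fst (accum S F i)" and ?e = "snd (accum S F i)"
  let ?b = "?a * F i div S" and ?P = "\<Prod>j<i. F j / S"
  define x where "x = ?a / S / 2 ^ ?e"
  define f where "f = F i / S"
  have IH: "?P * (1 - 2 / S) ^ i \<le> x" "x \<le> ?P" using Suc by (auto simp: x_def)
  have a: "S \<le> ?a" using accum_bounds[of S i F] assms(1) Suc.prems by auto
  have F: "S \<le> 2 * F i" using Suc.prems by auto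
  have S: "real S > 0" using assms(1) by simp
  have val: "fst (accum S F (Suc i)) / S / 2 ^ snd (accum S F (Suc i)) = ?b / S / 2 ^ ?e"
    by (simp add: Let_def)
  have fl: "real ?b \<le> real (?a * F i) / S" "real (?a * F i) / S - 1 \<le> real ?b"
    using floor_divide_of_nat_eq[of "?a * F i" S, where 'a = real] by linarith+
  have af: "real (?a * F i) / S / S / 2 ^ ?e = x * f" using S by (simp add: x_def f_def)
  have "?b / S / 2 ^ ?e \<le> real (?a * F i) / S / S / 2 ^ ?e"
    using fl by (intro divide_right_mono) auto
  then have up: "?b / S / 2 ^ ?e \<le> x * f" unfolding af .
  \<comment> \<open>The quotient being rounded is at least \<open>S / 2\<close>, so rounding it down
    loses at most the fraction \<open>2 / S\<close>.\<close>
  have "S * S \<le> ?a * (2 * F i)" using a F by (intro mult_le_mono)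
  then have "real S * real S \<le> 2 * real (?a * F i)" by (simp flip: of_nat_mult add: mult.assoc mult.left_commute)
  then have "1 \<le> real (?a * F i) / S * (2 / S)" using S by (simp add: field_simps)
  then have "real (?a * F i) / S * (1 - 2 / S) \<le> real ?b" using fl by (simp add: right_diff_distrib)
  then have "real (?a * F i) / S * (1 - 2 / S) / S / 2 ^ ?e \<le> ?b / S / 2 ^ ?e"
    by (intro divide_right_mono) auto
  also have "real (?a * F i) / S * (1 - 2 / S) / S / 2 ^ ?e = real (?a * F i) / S / S / 2 ^ ?e * (1 - 2 / S)"
    by simp
  finally have low: "x * f * (1 - 2 / S) \<le> ?b / S / 2 ^ ?e" unfolding af .
  have f0: "0 \<le> f" "0 \<le> 1 - 2 / real S" using assms(1) by (auto simp: f_def)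
  have "?P * (1 - 2 / S) ^ i * (f * (1 - 2 / S)) \<le> x * (f * (1 - 2 / S))"
    using IH f0 by (intro mult_right_mono) auto
  moreover have "x * f \<le> ?P * f" using IH f0 by (intro mult_right_mono) auto
  moreover have "(\<Prod>j<Suc i. F j / S) * (1 - 2 / S) ^ Suc i = ?P * (1 - 2 / S) ^ i * (f * (1 - 2 / S))"
    "(\<Prod>j<Suc i. F j / S) = ?P * f" by (simp_all add: f_def)
  moreover have "x * (f * (1 - 2 / S)) = x * f * (1 - 2 / S)" by simp
  ultimately show ?case using up low unfolding val by linarith
qed

context machine
begin

text \<open>At root \<open>i\<close> the vertices up to \<open>i\<close> are removed, so the exact
  ratios compare the sets of vertices from \<open>i\<close> and from \<open>i + 1\<close> on, and
  their product telescopes.\<close>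

definition root_value :: "nat \<Rightarrow> nat \<Rightarrow> nat" where
  "root_value b i = marginal S nb b {..i} i"

lemma root_value_bounds: "i < n \<Longrightarrow> root_value b i \<le> S \<and> S \<le> 2 * root_value b i"
  using marginal_ge[of i "{..i}" b] by (auto simp: root_value_def marginal.simps)

lemma root_loop:
  assumes "i + k = n" "consts_ok r" "input_ok m" "r 10 = i" "r 7 = b" "r 0 = fst (accum S (root_value b) i)"
    "r 2 = ex + snd (accum S (root_value b) i)" "\<And>u. u < n \<Longrightarrow> m (MB + u) = (if u < i then 1 else 0)"
    and B: "MB + n + 5 * b \<le> B" "ex + n \<le> B"
  shows "reaches prog \<epsilon> B (k * (64 * 2 ^ b + 14) + 2) (cfg 27 r m) (\<lambda>s. \<exists>r' m'. s = cfg 97 r' m' \<and>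
    r' 0 = fst (accum S (root_value b) n) \<and> r' 1 = r 1 \<and> r' 2 = ex + snd (accum S (root_value b) n))"
  using assms(1-8)
proof (induction k arbitrary: i r m)
  case 0
  note [simp] = 0(2)[unfolded consts_ok_def, simplified] 0(4)
  have "i = n" using 0 by simp
  then have [simp]: "\<not> i < n" by simp
  show ?case
    apply simp
    apply (rule reaches_step, simp, simp, simp, simp)+
    apply (rule reaches_refl)
    using 0 \<open>i = n\<close> apply auto
    done
next
  case (Suc k)
  note P = Suc.prems
  have i: "i < n" using P(1) by simp
  let ?m = "m(MB + i := 1)"
  let ?F = "root_value b"
  let ?Q1 = "\<lambda>s. \<exists>r'. s = cfg 34 r' ?m \<and> keep r r' \<and> r' 12 = MB + n \<and> r' 13 = b \<and> r' 21 = i"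
  let ?Q2 = "\<lambda>s. \<exists>r' m'. s = cfg 75 r' m' \<and> keep r r' \<and> r' 12 = MB + n \<and> r' 18 = ?F i \<and> (\<forall>a<MB + n. m' a = ?m a)"
  let ?Q3 = "\<lambda>s. \<exists>r' m'. s = cfg 27 r' m' \<and> consts_ok r' \<and> r' 1 = r 1 \<and> r' 7 = b \<and> r' 10 = Suc i \<and>
    r' 0 = fst (accum S ?F (Suc i)) \<and> r' 2 = ex + snd (accum S ?F (Suc i)) \<and> (\<forall>a<MB + n. m' a = ?m a)"
  let ?Q4 = "\<lambda>s. \<exists>r' m'. s = cfg 97 r' m' \<and>
    r' 0 = fst (accum S ?F n) \<and> r' 1 = r 1 \<and> r' 2 = ex + snd (accum S ?F n)"
  have 1: "reaches prog \<epsilon> B 6 (cfg 27 r m) ?Q1"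
    by (rule root_start[OF P(2,4) i]) (use P(5) B in auto)
  have min: "input_ok ?m" using P(3) by (rule input_ok_cong) auto
  have 2: "reaches prog \<epsilon> B (64 * 2 ^ b) s ?Q2" if s: "?Q1 s" for s
  proof -
    obtain r1 where r1: "s = cfg 34 r1 ?m" "keep r r1" "r1 12 = MB + n" "r1 13 = b" "r1 21 = i"
      using s by blast
    \<comment> \<open>The stack begins at \<open>MB + n\<close>, which exceeds the mark 1 of former
      roots; hence no call ever clears these marks.\<close>
    have marks: "\<forall>u<n. (u \<in> {..i} \<longleftrightarrow> ?m (MB + u) > 0) \<and> ?m (MB + u) < MB + n"
      using P(8) MB i by auto
    have "reaches prog \<epsilon> B (64 * 2 ^ b) s (\<lambda>s. \<exists>r' m'. s = cfg 75 r' m' \<and> keep r1 r' \<and> r' 12 = MB + n \<and>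
      r' 18 = marginal S nb b {..i} i \<and> (\<forall>a<MB + n. m' a = ?m a))"
      unfolding r1(1)
      by (rule node_correct[of b, unfolded node_spec_def, rule_format, of r1 ?m i "{..i}" "MB + n"])
        (use r1 i B min marks consts_ok_keep[OF P(2) r1(2)] in auto)
    then show ?thesis
      by (rule reaches_mono) (use keep_trans[OF r1(2)] in \<open>auto simp: root_value_def\<close>)
  qed
  have 3: "reaches prog \<epsilon> B 8 s ?Q3" if s: "?Q2 s" for s
  proof -
    obtain r1 m1 where r1: "s = cfg 75 r1 m1" "keep r r1" "r1 12 = MB + n" "r1 18 = ?F i" "\<forall>a<MB + n. m1 a = ?m a"
      using s by blast
    have same: "r1 0 = fst (accum S ?F i)" "r1 2 = ex + snd (accum S ?F i)" "r1 10 = i" "r1 1 = r 1" "r1 7 = b"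
      using r1(2) P by (auto simp: keep_def)
    have bounds: "S \<le> fst (accum S ?F i) \<and> fst (accum S ?F i) \<le> 2 * S \<and> snd (accum S ?F i) \<le> i"
      using root_value_bounds i S by (intro accum_bounds) auto
    have ok: "consts_ok r1" by (rule consts_ok_keep[OF P(2) r1(2)])
    show ?thesis unfolding r1(1)
    proof (rule root_finish[OF ok same(3) i r1(3)])
      show "r1 0 \<le> 2 * S" "r1 18 \<le> S" "r1 2 < B"
        using bounds same root_value_bounds[OF i] r1(4) B i by auto
      fix r' assume r': "\<And>j. j < 12 \<Longrightarrow> j \<noteq> 0 \<Longrightarrow> j \<noteq> 2 \<Longrightarrow> j \<noteq> 10 \<Longrightarrow> r' j = r1 j" "r' 10 = i + 1"
        "r' 0 = (let a = r1 0 * r1 18 div S in if a < S then 2 * a else a)"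
        "r' 2 = (if r1 0 * r1 18 div S < S then r1 2 + 1 else r1 2)"
      show "?Q3 (cfg 27 r' m1)"
        apply (rule exI[of _ r'], rule exI[of _ m1])
        using r' ok same r1(4,5) by (auto simp: consts_ok_def Let_def)
    qed
  qed
  have 4: "reaches prog \<epsilon> B (k * (64 * 2 ^ b + 14) + 2) s ?Q4" if s: "?Q3 s" for s
  proof -
    obtain r1 m1 where r1: "s = cfg 27 r1 m1" "consts_ok r1" "r1 1 = r 1" "r1 7 = b" "r1 10 = Suc i"
      "r1 0 = fst (accum S ?F (Suc i))" "r1 2 = ex + snd (accum S ?F (Suc i))" "\<And>a. a < MB + n \<Longrightarrow> m1 a = ?m a"
      using s by blast
    have m1: "input_ok m1" using P(3) by (rule input_ok_cong) (use r1(8) in auto)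
    have "reaches prog \<epsilon> B (k * (64 * 2 ^ b + 14) + 2) s (\<lambda>s. \<exists>r' m'. s = cfg 97 r' m' \<and>
      r' 0 = fst (accum S ?F n) \<and> r' 1 = r1 1 \<and> r' 2 = ex + snd (accum S ?F n))"
      unfolding r1(1)
    proof (rule Suc.IH[OF _ r1(2) m1 r1(5,4,6,7)])
      fix u assume "u < n"
      then show "m1 (MB + u) = (if u < Suc i then 1 else 0)" using r1(8)[of "MB + u"] P(8)[of u] by auto
    qed (use P(1) in simp)
    then show ?thesis unfolding r1(3) .
  qed
  have "reaches prog \<epsilon> B (6 + (64 * 2 ^ b + (8 + (k * (64 * 2 ^ b + 14) + 2)))) (cfg 27 r m) ?Q4"
    by (rule reaches_trans[OF 1 reaches_trans[OF 2 reaches_trans[OF 3 4]]])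
  then show ?case by (rule reaches_mono) auto
qed

section \<open>Initialisation: scale, budget and addresses\<close>

lemma scale_loop:
  assumes "l + k = L" "r 22 = 2 ^ l" "r 6 = 1024 * 2 ^ l" "r 2 = 10 + l" "r 7 = 56 + 28 * l"
    "r 3 = n" "r 4 = 1" "r 20 = 28"
    and L: "S = 1024 * 2 ^ L" "\<And>l. l < L \<Longrightarrow> \<not> real n < \<epsilon> * 2 ^ l" "real n < \<epsilon> * 2 ^ L" "56 + 28 * L \<le> B"
  shows "reaches prog \<epsilon> B (6 * k + 1) (cfg 8 r m) (\<lambda>s. \<exists>r'. s = cfg 14 r' m \<and> r' 6 = S \<and> r' 2 = 10 + L \<and>
    r' 7 = 56 + 28 * L \<and> (\<forall>i<20. i \<noteq> 2 \<and> i \<noteq> 6 \<and> i \<noteq> 7 \<longrightarrow> r' i = r i))"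
  using assms(1-8)
proof (induction k arbitrary: l r)
  case 0
  have [simp]: "real n < \<epsilon> * 2 ^ l" using 0 L by simp
  note [simp] = 0
  show ?case
    apply (rule reaches_step, simp, simp, simp, simp)
    apply (rule reaches_refl, rule exI[of _ r])
    using 0 L by auto
next
  case (Suc k)
  have "2 ^ Suc l \<le> (2::nat) ^ L" using Suc.prems(1) by (intro power_increasing) auto
  then have le: "1024 * 2 ^ Suc l \<le> B" using L(1) S_le_B by linarith
  have l: "l < L" using Suc.prems(1) by simp
  note [simp] = Suc.prems(2-8)
  have [simp]: "\<not> real n < \<epsilon> * 2 ^ l" using L(2)[OF l] .
  have [simp]: "2 ^ l + 2 ^ l \<le> B" "2048 * 2 ^ l \<le> B" using le by simp_all
  have [simp]: "11 + l \<le> B" "84 + 28 * l \<le> B" using L(4) l by linarith+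
  let ?r = "r(22 := 2 ^ l + 2 ^ l, 6 := 2048 * 2 ^ l, 2 := 11 + l, 7 := 84 + 28 * l)"
  have "reaches prog \<epsilon> B 6 (cfg 8 r m) (\<lambda>s. s = cfg 8 ?r m)"
    apply (rule reaches_step, simp, simp, simp, simp)+
    apply (rule reaches_refl)
    apply simp
    done
  then have "reaches prog \<epsilon> B (6 + (6 * k + 1)) (cfg 8 r m) (\<lambda>s. \<exists>r'. s = cfg 14 r' m \<and> r' 6 = S \<and> r' 2 = 10 + L \<and>
    r' 7 = 56 + 28 * L \<and> (\<forall>i<20. i \<noteq> 2 \<and> i \<noteq> 6 \<and> i \<noteq> 7 \<longrightarrow> r' i = r i))"
  proof (rule reaches_trans)
    fix s assume s: "s = cfg 8 ?r m"
    have "reaches prog \<epsilon> B (6 * k + 1) s (\<lambda>s. \<exists>r'. s = cfg 14 r' m \<and> r' 6 = S \<and> r' 2 = 10 + L \<and>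
      r' 7 = 56 + 28 * L \<and> (\<forall>i<20. i \<noteq> 2 \<and> i \<noteq> 6 \<and> i \<noteq> 7 \<longrightarrow> r' i = ?r i))"
      unfolding s by (rule Suc.IH[of "Suc l"]) (use Suc.prems(1) in auto)
    then show "reaches prog \<epsilon> B (6 * k + 1) s (\<lambda>s. \<exists>r'. s = cfg 14 r' m \<and> r' 6 = S \<and> r' 2 = 10 + L \<and>
      r' 7 = 56 + 28 * L \<and> (\<forall>i<20. i \<noteq> 2 \<and> i \<noteq> 6 \<and> i \<noteq> 7 \<longrightarrow> r' i = r i))"
      by (rule reaches_mono) auto
  qed
  then show ?case by (rule reaches_mono) auto
qed

text \<open>The end of the input is the end of the last vertex's list. As the input has
  \<open>1 + 2 * n + 4 * m\<close> cells, this also yields the number \<open>m\<close> of edges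
  without scanning lists whose lengths are not bounded in terms of \<open>n\<close>.\<close>

lemma setup_addresses:
  assumes r: "r 3 = n" "r 4 = 1" "r 5 = 2" "r 6 = S" "r 11 = 0" "r 10 = 0"
    and m: "input_ok m" and n: "0 < n" and last: "MB = start (n - 1) + 2 * length (nb (n - 1))"
  shows "reaches prog \<epsilon> B 13 (cfg 14 r m) (\<lambda>s. \<exists>r'. s = cfg 27 r' m \<and> consts_ok r' \<and> r' 0 = S \<and>
    r' 1 = (MB - 1 - 2 * n) div 4 \<and> r' 2 = r 2 \<and> r' 7 = r 7 \<and> r' 10 = 0)"
proof -
  obtain k where k: "n = Suc k" using n by (cases n) auto
  have mv: "m (k + n) = length (nb k)" "m (n + n) = start k"
  proof -
    have "k + n = 2 * k + 1" "n + n = 2 * k + 2" "k < n" using k by auto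
    then show "m (k + n) = length (nb k)" "m (n + n) = start k" using m unfolding input_ok_def by metis+
  qed
  have "n - 1 = k" using k by simp
  then have last': "start k + (length (nb k) + length (nb k)) = MB" using last by simp
  have le: "n + n \<le> B" "length (nb k) + length (nb k) \<le> B" "MB \<le> B" "S \<le> B" "n + n - Suc 0 = k + n"
    using MB last' S_le_B k by linarith+
  note [simp] = r mv le last' MB(2)
  show ?thesis
    apply (rule reaches_step, simp, simp, simp, simp)+
    apply (rule reaches_refl)
    apply (simp add: consts_ok_def)
    done
qed

text \<open>Register 2 starts at 10 because 1024 is \<open>2 ^ 10\<close>. It ends as the binary
  logarithm of \<open>S\<close>, so the final exponent also removes the fixed-point scale from the
  mantissa.\<close>

lemma init:
  assumes m: "input_ok m" "m 0 = n" and n: "0 < n" and last: "MB = start (n - 1) + 2 * length (nb (n - 1))"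
    and L: "S = 1024 * 2 ^ L" "\<And>l. l < L \<Longrightarrow> \<not> real n < \<epsilon> * 2 ^ l" "real n < \<epsilon> * 2 ^ L" "56 + 28 * L \<le> B"
  shows "reaches prog \<epsilon> B (6 * L + 22) (cfg 0 (\<lambda>_. 0) m) (\<lambda>s. \<exists>r'. s = cfg 27 r' m \<and> consts_ok r' \<and> r' 0 = S \<and>
    r' 1 = (MB - 1 - 2 * n) div 4 \<and> r' 2 = 10 + L \<and> r' 7 = 56 + 28 * L \<and> r' 10 = 0)"
proof -
  have "1 \<le> (2::nat) ^ L" by simp
  then have "1024 \<le> B" using L(1) S_le_B by linarith
  then have [simp]: "1024 \<le> B" "Suc 0 \<le> B" "2 \<le> B" "10 \<le> B" "56 \<le> B" "28 \<le> B" by linarith+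
  note [simp] = m(2) numeral_2_eq_2[symmetric]
  let ?r = "(\<lambda>_. 0 :: nat)(4 := 1, 5 := 2, 3 := n, 6 := 1024, 2 := 10, 7 := 56, 20 := 28, 22 := 1)"
  have 1: "reaches prog \<epsilon> B 8 (cfg 0 (\<lambda>_. 0) m) (\<lambda>s. s = cfg 8 ?r m)"
    apply (rule reaches_step, simp, simp, simp, simp)+
    apply (rule reaches_refl)
    apply simp
    done
  let ?Q2 = "\<lambda>s. \<exists>r'. s = cfg 14 r' m \<and> r' 6 = S \<and> r' 2 = 10 + L \<and>
    r' 7 = 56 + 28 * L \<and> (\<forall>i<20. i \<noteq> 2 \<and> i \<noteq> 6 \<and> i \<noteq> 7 \<longrightarrow> r' i = ?r i)"
  have 2: "reaches prog \<epsilon> B (6 * L + 1) s ?Q2" if s: "s = cfg 8 ?r m" for s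
    unfolding s by (rule scale_loop[of 0 L L, OF _ _ _ _ _ _ _ _ L]) auto
  let ?Q3 = "\<lambda>s. \<exists>r'. s = cfg 27 r' m \<and> consts_ok r' \<and> r' 0 = S \<and>
    r' 1 = (MB - 1 - 2 * n) div 4 \<and> r' 2 = 10 + L \<and> r' 7 = 56 + 28 * L \<and> r' 10 = 0"
  have 3: "reaches prog \<epsilon> B 13 s ?Q3" if s: "?Q2 s" for s
  proof -
    obtain r1 where r1: "s = cfg 14 r1 m" "r1 6 = S" "r1 2 = 10 + L" "r1 7 = 56 + 28 * L"
      "\<And>i. i < 20 \<Longrightarrow> i \<noteq> 2 \<Longrightarrow> i \<noteq> 6 \<Longrightarrow> i \<noteq> 7 \<Longrightarrow> r1 i = ?r i" using s by blast
    have "reaches prog \<epsilon> B 13 s (\<lambda>s. \<exists>r'. s = cfg 27 r' m \<and> consts_ok r' \<and> r' 0 = S \<and>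
      r' 1 = (MB - 1 - 2 * n) div 4 \<and> r' 2 = r1 2 \<and> r' 7 = r1 7 \<and> r' 10 = 0)"
      unfolding r1(1) by (rule setup_addresses[OF _ _ _ _ _ _ m(1) n last]) (use r1 in auto)
    then show ?thesis unfolding r1 .
  qed
  have "reaches prog \<epsilon> B (8 + ((6 * L + 1) + 13)) (cfg 0 (\<lambda>_. 0) m) ?Q3"
    by (rule reaches_trans[OF 1 reaches_trans[OF 2 3]])
  then show ?thesis by (rule reaches_mono) auto
qed

end


section \<open>Memory layout and numerical bounds\<close>

lemma length_concat_upt: "length (concat (map f [0..<n])) = (\<Sum>u<n. length (f u))"
  by (induction n) auto

lemma nth_concat_upt:
  "v < n \<Longrightarrow> j < length (f v) \<Longrightarrow> concat (map f [0..<n]) ! ((\<Sum>u<v. length (f u)) + j) = f v ! j"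
proof (induction n)
  case (Suc n)
  show ?case
  proof (cases "v = n")
    case True
    then show ?thesis by (simp add: nth_append length_concat_upt)
  next
    case False
    then have "v < n" using Suc by simp
    have "(\<Sum>u<v. length (f u)) + j < (\<Sum>u<Suc v. length (f u))" using Suc by simp
    also have "\<dots> \<le> (\<Sum>u<n. length (f u))" using \<open>v < n\<close> by (intro sum_mono2) auto
    finally show ?thesis using Suc.IH[OF \<open>v < n\<close> Suc.prems(2)] by (simp add: nth_append length_concat_upt)
  qed
qed simp

lemma length_concat_pairs: "length (concat (map (\<lambda>(u, e). [u, e]) ps)) = 2 * length ps"
  by (induction ps) auto

lemma nth_concat_pairs:
  "j < length ps \<Longrightarrow> concat (map (\<lambda>(u, e). [u, e]) ps) ! (2 * j) = fst (ps ! j)"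
proof (induction ps arbitrary: j)
  case (Cons p ps)
  then show ?case by (cases j) (auto split: prod.splits)
qed simp

lemma length_encode: "length (encode n A) = 1 + 2 * n + 2 * (\<Sum>u<n. length (A u))"
proof -
  have "length (concat (map (\<lambda>v. [length (A v), start_address n A v]) [0..<n])) = 2 * n"
    unfolding length_concat_upt by simp
  moreover have "length (concat (map (\<lambda>v. concat (map (\<lambda>(u, e). [u, e]) (A v))) [0..<n])) = 2 * (\<Sum>u<n. length (A u))"
    unfolding length_concat_upt length_concat_pairs by (simp add: sum_distrib_left)
  ultimately show ?thesis by (simp add: encode_def del: length_concat)
qed

lemma encode_nth:
  assumes "v < n"
  shows "encode n A ! (2 * v + 1) = length (A v)" "encode n A ! (2 * v + 2) = start_address n A v"
    and "j < length (A v) \<Longrightarrow> encode n A ! (start_address n A v + 2 * j) = fst (A v ! j)"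
proof -
  let ?f = "\<lambda>v. [length (A v), start_address n A v]" and ?g = "\<lambda>v. concat (map (\<lambda>(u, e). [u, e]) (A v))"
  let ?X = "concat (map ?f [0..<n])" and ?Y = "concat (map ?g [0..<n])"
  have X: "length ?X = 2 * n" unfolding length_concat_upt by simp
  have "?X ! (2 * v + i) = ?f v ! i" if "i < 2" for i
    using nth_concat_upt[OF assms, of i ?f] that by (simp add: mult_2)
  from this[of 0] this[of 1] have *: "?X ! (2 * v) = length (A v)" "?X ! (2 * v + 1) = start_address n A v" by auto
  show "encode n A ! (2 * v + 1) = length (A v)"
    using * X assms unfolding encode_def by (simp add: nth_append del: length_concat)
  show "encode n A ! (2 * v + 2) = start_address n A v"
    using * X assms unfolding encode_def by (simp add: nth_append del: length_concat)
  assume j: "j < length (A v)"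
  have "?Y ! ((\<Sum>u<v. length (?g u)) + 2 * j) = ?g v ! (2 * j)"
    using j by (intro nth_concat_upt assms) (simp add: length_concat_pairs del: length_concat)
  also have "\<dots> = fst (A v ! j)" using j by (rule nth_concat_pairs)
  finally have "?Y ! (2 * (\<Sum>u<v. length (A u)) + 2 * j) = fst (A v ! j)"
    unfolding length_concat_pairs by (simp add: sum_distrib_left)
  then show "encode n A ! (start_address n A v + 2 * j) = fst (A v ! j)"
    using X unfolding encode_def start_address_def by (simp add: nth_append add.assoc del: length_concat)
qed

lemma adjacency_list_sink_free_graph:
  assumes wf: "wf_multigraph G" and adj: "adjacency_list G A" and deg: "min_degree G \<ge> 3"
  shows "sink_free_graph G (\<lambda>v. map fst (A v))"
proof
  fix v assume v: "v \<in> verts G"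
  have A: "distinct (A v)" "set (A v) = {(u, e). e \<in> edges G \<and> ends G e = {v, u}}"
    using adj v by (auto simp: adjacency_list_def)
  have "finite (verts G)" using wf by (simp add: wf_multigraph_def)
  then have "min_degree G \<le> vdegree G v" using v unfolding min_degree_def by (intro Min_le) auto
  then show "3 \<le> vdegree G v" using deg by simp
  \<comment> \<open>Neighbours may repeat, edge numbers do not: the edge and one of its ends
    determine the other end. So the list has one entry per edge at \<open>v\<close>.\<close>
  have "bij_betw snd (set (A v)) {e \<in> edges G. v \<in> ends G e}"
  proof (rule bij_betw_imageI)
    show "inj_on snd (set (A v))" unfolding A by (auto simp: inj_on_def doubleton_eq_iff)
    have "\<exists>u. ends G e = {v, u}" if "e \<in> edges G" "v \<in> ends G e" for e
    proof -
      have "card (ends G e) = 2" using wf that by (auto simp: wf_multigraph_def)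
      then obtain a b where "ends G e = {a, b}" by (auto simp: card_2_iff)
      with that show ?thesis by auto
    qed
    then show "snd ` set (A v) = {e \<in> edges G. v \<in> ends G e}" unfolding A by force
  qed
  then show "length (map fst (A v)) = vdegree G v"
    using A(1) by (simp add: vdegree_def bij_betw_same_card flip: distinct_card)
  show "set (map fst (A v)) = neighbours G v" unfolding set_map A(2) neighbours_def by force
qed (rule wf)

context sink_free_graph
begin

text \<open>Removing the vertices one by one leads from \<open>verts G\<close> to the empty set, for
  which all \<open>2 ^ card (edges G)\<close> orientations count.\<close>

lemma prod_ratio:
  fixes f :: "nat \<Rightarrow> 'v"
  assumes inj: "inj_on f {..<n}" and "verts G = f ` {..<n}"
  shows "(\<Prod>i<n. ratio (f i) (verts G - f ` {..i})) = cnt (verts G) / 2 ^ card (edges G)"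
proof -
  have "(\<Prod>i<k. ratio (f i) (verts G - f ` {..i})) = cnt (verts G) / cnt (verts G - f ` {..<k})" if "k \<le> n" for k
    using that
  proof (induction k)
    case 0
    then show ?case using cnt_pos[of "verts G"] by simp
  next
    case (Suc k)
    have "f k \<notin> f ` {..<k}"
    proof
      assume "f k \<in> f ` {..<k}"
      then obtain x where "x < k" "f k = f x" by auto
      then show False using inj_onD[OF inj, of k x] Suc.prems by simp
    qed
    then have "insert (f k) (verts G - f ` {..k}) = verts G - f ` {..<k}"
      using assms(2) Suc.prems by (auto simp flip: lessThan_Suc_atMost simp: lessThan_Suc)
    then have "ratio (f k) (verts G - f ` {..k}) = cnt (verts G - f ` {..<k}) / cnt (verts G - f ` {..<Suc k})"
      by (simp add: ratio_def lessThan_Suc_atMost)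
    moreover have "cnt (verts G - f ` {..<k}) \<noteq> 0" using cnt_pos[of "verts G - f ` {..<k}"] by auto
    ultimately show ?case using Suc by simp
  qed
  from this[of n] have "(\<Prod>i<n. ratio (f i) (verts G - f ` {..i})) = cnt (verts G) / cnt {}"
    using assms(2) by simp
  moreover have "nonsinks G {} = orientations G" by (simp add: nonsinks_def)
  ultimately show ?thesis using card_orientations[OF wf] by (simp add: cnt_def)
qed

lemma cnt_verts: "cnt (verts G) = real (card (sink_free_orientations G))"
  by (simp add: cnt_def nonsinks_def sink_free_orientations_def)

end

section \<open>Accuracy and running time as real inequalities\<close>

lemma err_bound:
  assumes L: "real n < \<epsilon> * 2 ^ L" and n: "0 < n"
  shows "err (1024 * 2 ^ L) (56 + 28 * L) \<le> 3/8 * (\<epsilon> / n)"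
proof -
  have y: "1 / 2 ^ L \<le> \<epsilon> / n" using L n by (simp add: field_simps)
  \<comment> \<open>Each 28 units of budget halve the truncation error; the initial 56 give the
    factor 1/4. The scale 1024 turns 96 into less than 1/8, and the two add up to 3/8.\<close>
  have "56 + 28 * L = 28 * (L + 2)" by simp
  then have "(39/40::real) ^ (56 + 28 * L) = ((39/40) ^ 28) ^ (L + 2)" by (simp only: power_mult)
  also have "\<dots> \<le> (1/2) ^ (L + 2)" by (intro power_mono) (auto simp: power_divide)
  also have "\<dots> = 1/4 * (1 / 2 ^ L)" by (simp add: power_divide)
  finally have "(39/40::real) ^ (56 + 28 * L) \<le> 1/4 * (1 / 2 ^ L)" .
  moreover have "96 / real (1024 * 2 ^ L) \<le> 1/8 * (1 / 2 ^ L)" by (simp add: field_simps)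
  ultimately have "err (1024 * 2 ^ L) (56 + 28 * L) \<le> 3/8 * (1 / 2 ^ L)" unfolding err_def by linarith
  also have "\<dots> \<le> 3/8 * (\<epsilon> / n)" using y by (intro mult_left_mono) auto
  finally show ?thesis .
qed

lemma power_le_one_plus:
  fixes \<epsilon> :: real
  assumes "0 < \<epsilon>" "\<epsilon> < 1" "0 < n"
  shows "(1 + \<epsilon> / (2 * real n)) ^ n \<le> 1 + \<epsilon>"
proof -
  have "(1 + \<epsilon> / (2 * real n)) ^ n \<le> exp (\<epsilon> / (2 * real n)) ^ n"
    using assms exp_ge_add_one_self[of "\<epsilon> / (2 * real n)"] by (intro power_mono) auto
  also have "\<dots> = exp (\<epsilon> / 2)" using assms by (simp flip: exp_of_nat_mult)
  also have "\<dots> \<le> 1 + \<epsilon> / 2 + (\<epsilon> / 2)\<^sup>2" using assms by (intro exp_bound) auto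
  also have "\<dots> \<le> 1 + \<epsilon>"
  proof -
    have "\<epsilon> * \<epsilon> \<le> \<epsilon> * 1" using assms by (intro mult_left_mono) auto
    moreover have "(\<epsilon> / 2)\<^sup>2 = \<epsilon> * \<epsilon> / 4" by (simp add: power2_eq_square)
    ultimately show ?thesis using assms by linarith
  qed
  finally show ?thesis .
qed

lemma accuracy:
  fixes F :: "nat \<Rightarrow> nat" and g :: "nat \<Rightarrow> real"
  assumes \<epsilon>: "0 < \<epsilon>" "\<epsilon> < 1" and n: "0 < n" and L: "real n < \<epsilon> * 2 ^ L" and S: "S = 1024 * 2 ^ L"
    and g: "\<And>i. i < n \<Longrightarrow> 3/4 \<le> g i"
    and F: "\<And>i. i < n \<Longrightarrow> g i \<le> F i / S \<and> F i / S \<le> g i + err S (56 + 28 * L)"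
      "\<And>i. i < n \<Longrightarrow> F i \<le> S \<and> S \<le> 2 * F i"
    and Z: "(\<Prod>i<n. g i) = Z / 2 ^ M"
  shows "is_approximation \<epsilon> Z (real (fst (accum S F n)) * 2 ^ M / 2 ^ (10 + L + snd (accum S F n)))"
proof -
  let ?P = "\<Prod>i<n. g i" and ?Q = "\<Prod>i<n. F i / S"
  let ?X = "fst (accum S F n) / S / 2 ^ snd (accum S F n)"
  have Spos: "real S > 0" and S2: "2 \<le> S"
  proof -
    have "1 \<le> (2::nat) ^ L" by simp
    then show "2 \<le> S" unfolding S by linarith
    then show "real S > 0" by simp
  qed
  have gpos: "0 < g i" if "i < n" for i using g[OF that] by linarith
  then have P: "?P > 0" by (intro prod_pos) auto
  have X: "?Q * (1 - 2 / S) ^ n \<le> ?X" "?X \<le> ?Q" using accum_value[OF S2, of n F] F(2) by auto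
  have PQ: "?P \<le> ?Q" using less_imp_le[OF gpos] F(1) by (intro prod_mono) auto
  have "?Q \<le> (\<Prod>i<n. g i * (1 + \<epsilon> / (2 * real n)))"
  proof (intro prod_mono conjI)
    fix i assume i: "i \<in> {..<n}"
    have "F i / S \<le> g i + 3/4 * (\<epsilon> / (2 * real n))"
      using F(1)[of i] err_bound[OF L n] i unfolding S by auto
    \<comment> \<open>Since 3/8 is half of the lower bound 3/4 for the exact ratios, the additive
      error becomes a relative error of \<open>\<epsilon> / (2 * n)\<close>.\<close>
    also have "3/4 * (\<epsilon> / (2 * real n)) \<le> g i * (\<epsilon> / (2 * real n))" using g[of i] \<epsilon> i by (intro mult_right_mono) auto
    finally show "F i / S \<le> g i * (1 + \<epsilon> / (2 * real n))" by (simp add: distrib_left)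
  qed simp
  also have "\<dots> = ?P * (1 + \<epsilon> / (2 * real n)) ^ n" by (simp add: prod.distrib)
  also have "\<dots> \<le> ?P * (1 + \<epsilon>)" using P power_le_one_plus[OF \<epsilon> n] by (intro mult_left_mono) auto
  finally have up: "?X \<le> ?P * (1 + \<epsilon>)" using X by simp
  \<comment> \<open>The approximate ratios are never too small, so below only the rounding of the
    mantissa counts: a factor \<open>1 - 2 / S\<close> for each vertex, estimated by Bernoulli's
    inequality.\<close>
  have "1 - \<epsilon> \<le> 1 + real n * (- (2 / S))"
  proof -
    have "2 * real n \<le> 2 * (\<epsilon> * 2 ^ L)" using L by simp
    also have "\<dots> \<le> \<epsilon> * S" using \<epsilon> by (simp add: S)
    finally have "real n * (2 / S) \<le> \<epsilon>" using Spos by (simp add: field_simps)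
    then show ?thesis by simp
  qed
  also have "\<dots> \<le> (1 + - (2 / S)) ^ n" using S2 by (intro Bernoulli_inequality) (auto simp: field_simps)
  finally have "?P * (1 - \<epsilon>) \<le> ?Q * (1 - 2 / S) ^ n" using P PQ \<epsilon> by (intro mult_mono) auto
  then have low: "?P * (1 - \<epsilon>) \<le> ?X" using X by simp
  have res: "real (fst (accum S F n)) * 2 ^ M / 2 ^ (10 + L + snd (accum S F n)) = ?X * 2 ^ M"
    unfolding S by (simp add: power_add)
  have Zpos: "Z > 0" using P unfolding Z by (simp add: zero_less_divide_iff)
  have ZP: "Z = ?P * 2 ^ M" unfolding Z by simp
  have "(1 - \<epsilon>) * Z \<le> ?X * 2 ^ M" "?X * 2 ^ M \<le> (1 + \<epsilon>) * Z"
    using mult_right_mono[OF low, of "2 ^ M"] mult_right_mono[OF up, of "2 ^ M"] unfolding ZP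
    by (simp_all only: mult_ac) simp_all
  then show ?thesis unfolding is_approximation_def res
    using Zpos by (simp only: pos_le_divide_eq pos_divide_le_eq simp_thms)
qed

text \<open>Everything is charged to \<open>n * q ^ 28\<close> with
  \<open>q = n / \<epsilon>\<close>: 36 is 12 + 24, 78 is 64 + 14, and 84 is 56 + 28, the latter
  because \<open>2 ^ L\<close> may be as large as \<open>2 * q\<close>.\<close>

lemma running_time:
  assumes \<epsilon>: "0 < \<epsilon>" "\<epsilon> < 1" and n: "2 \<le> n" and L: "2 ^ L \<le> 2 * (real n / \<epsilon>)"
  shows "real (6 * L + 22 + (n * (64 * 2 ^ (56 + 28 * L) + 14) + 2))
    \<le> 2 * (36 + 78 * 2 ^ 84) * ((real n ^ 73 / \<epsilon> ^ 72) * ln (real n / \<epsilon>))"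
proof -
  define q where "q = real n / \<epsilon>"
  have q: "2 \<le> q" using \<epsilon> n unfolding q_def by (simp add: field_simps)
  have L1: "real L \<le> 2 ^ L" using of_nat_less_two_power[of L, where 'a = real] by simp
  have q28: "1 \<le> q ^ 28" "q \<le> q ^ 28" using q by (simp_all add: self_le_power)
  have n28: "q ^ 28 \<le> n * q ^ 28" using n q by simp
  have "(2::real) ^ (56 + 28 * L) = 2 ^ 56 * (2 ^ L) ^ 28" by (simp add: power_add power_mult mult.commute)
  also have "\<dots> \<le> 2 ^ 56 * (2 * q) ^ 28" using L by (intro mult_left_mono power_mono) (auto simp: q_def)
  also have "\<dots> = 2 ^ 84 * q ^ 28" by (simp add: power_mult_distrib)
  finally have b: "(2::real) ^ (56 + 28 * L) \<le> 2 ^ 84 * q ^ 28" .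
  have "real (6 * L + 22 + (n * (64 * 2 ^ (56 + 28 * L) + 14) + 2))
    = 6 * real L + 24 + real n * (64 * 2 ^ (56 + 28 * L) + 14)" by simp
  also have "\<dots> \<le> 12 * (n * q ^ 28) + 24 * (n * q ^ 28) + n * (64 * (2 ^ 84 * q ^ 28) + 14 * (2 ^ 84 * q ^ 28))"
  proof (intro add_mono mult_left_mono)
    show "6 * real L \<le> 12 * (n * q ^ 28)" using L L1 q28 n28 unfolding q_def[symmetric] by linarith
    show "24 \<le> 24 * (n * q ^ 28)" using q28 n28 by linarith
    show "14 \<le> 14 * (2 ^ 84 * q ^ 28)" using q28 by simp
  qed (use b in auto)
  also have "\<dots> = (36 + 78 * 2 ^ 84) * (n * q ^ 28)" by (simp add: algebra_simps)
  also have "\<dots> \<le> (36 + 78 * 2 ^ 84) * (n * q ^ 72)"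
    using q by (intro mult_left_mono power_increasing) auto
  also have "n * q ^ 72 = real n ^ 73 / \<epsilon> ^ 72" unfolding q_def
    by (simp add: power_divide flip: power_Suc)
  also have "(36 + 78 * 2 ^ 84) * (real n ^ 73 / \<epsilon> ^ 72) * 1
    \<le> (36 + 78 * 2 ^ 84) * (real n ^ 73 / \<epsilon> ^ 72) * (2 * ln q)"
  proof (intro mult_left_mono)
    have "ln 2 \<le> ln q" using q by simp
    \<comment> \<open>This gives \<open>ln 2 \<ge> 1/2\<close>, so the logarithmic factor costs no
      more than a factor 2 in the constant.\<close>
    moreover have "ln (1 / 2 :: real) \<le> 1 / 2 - 1" by (rule ln_le_minus_one) simp
    then have "1 \<le> 2 * ln (2::real)" by (simp add: ln_div)
    ultimately show "1 \<le> 2 * ln q" by linarith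
  qed (use \<epsilon> in auto)
  finally show ?thesis unfolding q_def by (simp add: mult_ac)
qed


section \<open>Correctness of the program\<close>

text \<open>The word exponent 13 is forced by the products. As \<open>W \<ge> 6\<close>, 1024 is
  below \<open>W ^ 4\<close>; \<open>2 ^ L\<close> is at most \<open>W ^ 2\<close>; so
  \<open>S \<le> W ^ 6\<close>, and twice its square is at most \<open>W ^ 13\<close>.\<close>

lemma size_bounds:
  fixes n M Q L W :: nat
  assumes "W = n + M + Q" "1 \<le> n" "3 \<le> M" "2 \<le> Q" and L: "2 ^ L \<le> 2 * n * Q"
  shows "2 * (1024 * 2 ^ L * (1024 * 2 ^ L)) \<le> W ^ 13"
    and "1 + 2 * n + 4 * M + n + 5 * (56 + 28 * L) \<le> W ^ 13"
    and "10 + L + n \<le> W ^ 13"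
proof -
  have W: "6 \<le> W" using assms by simp
  have "2 * (n * Q) \<le> (n + Q) ^ 2" by (simp add: power2_eq_square algebra_simps)
  also have "\<dots> \<le> W ^ 2" using assms(1) by (intro power_mono) auto
  finally have y: "2 ^ L \<le> W ^ 2" using L by (simp add: mult.assoc)
  have "(6::nat) ^ 4 \<le> W ^ 4" using W by (intro power_mono) auto
  then have 4: "1296 \<le> W ^ 4" by simp
  have "1024 * 2 ^ L \<le> W ^ 4 * W ^ 2" using y 4 by (intro mult_le_mono) auto
  then have S: "1024 * 2 ^ L \<le> W ^ 6" by (simp flip: power_add)
  have "2 * (1024 * 2 ^ L * (1024 * 2 ^ L)) \<le> W * (W ^ 6 * W ^ 6)"
    using W S by (intro mult_le_mono) auto
  also have "\<dots> = W ^ 13" by (simp flip: power_add power_Suc)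
  finally show "2 * (1024 * 2 ^ L * (1024 * 2 ^ L)) \<le> W ^ 13" .
  have Ly: "L < 2 ^ L" by (rule less_exp)
  have "W ^ 1 \<le> W ^ 6" using W by (intro power_increasing) auto
  then have w6: "W \<le> W ^ 6" by simp
  have "6 * W ^ 6 \<le> W * W ^ 6" using W by (rule mult_le_mono1)
  also have "\<dots> = W ^ 7" by (simp flip: power_Suc)
  also have "\<dots> \<le> W ^ 13" using W by (intro power_increasing) auto
  finally have w13: "6 * W ^ 6 \<le> W ^ 13" .
  have "W ^ 4 \<le> W ^ 6" using W by (intro power_increasing) auto
  with 4 have big: "1296 \<le> W ^ 6" by (rule le_trans)
  have "5 * (56 + 28 * L) \<le> 280 + 140 * 2 ^ L" using Ly by simp
  moreover have "1 + 2 * n + 4 * M + n \<le> 4 * W" using assms by simp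
  ultimately show "1 + 2 * n + 4 * M + n + 5 * (56 + 28 * L) \<le> W ^ 13"
    using w13 w6 S big by linarith
  show "10 + L + n \<le> W ^ 13" using w13 w6 S big Ly assms(1) by linarith
qed

lemma scaling_exponent:
  fixes \<epsilon> :: real
  assumes "0 < \<epsilon>" "\<epsilon> < 1" "0 < n"
  obtains L where "\<And>l. l < L \<Longrightarrow> \<not> real n < \<epsilon> * 2 ^ l" "real n < \<epsilon> * 2 ^ L" "2 ^ L \<le> 2 * (real n / \<epsilon>)"
proof -
  define L where "L = (LEAST l. real n < \<epsilon> * 2 ^ l)"
  obtain l where "real n / \<epsilon> < 2 ^ l" using real_arch_pow[of 2 "real n / \<epsilon>"] by auto
  then have "real n < \<epsilon> * 2 ^ l" using assms by (simp add: field_simps)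
  then have L: "real n < \<epsilon> * 2 ^ L" unfolding L_def by (rule LeastI)
  have less: "\<not> real n < \<epsilon> * 2 ^ l" if "l < L" for l
    using not_less_Least[of l "\<lambda>l. real n < \<epsilon> * 2 ^ l"] that unfolding L_def by blast
  \<comment> \<open>At exponent 0 the test fails because \<open>n \<ge> 1 > \<epsilon>\<close>. So
    \<open>L\<close> has a predecessor, and its failure bounds \<open>2 ^ L\<close> from
    above.\<close>
  have "L \<noteq> 0" using L assms by (intro notI) auto
  then obtain k where k: "L = Suc k" by (cases L) auto
  have "\<epsilon> * 2 ^ k \<le> real n" using less[of k] k by simp
  then have "2 ^ L \<le> 2 * (real n / \<epsilon>)" using assms by (simp add: k field_simps)
  with L less that show thesis by blast
qed

lemma prog_correct:
  fixes G :: "(nat, nat) multigraph"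
  assumes wf: "wf_multigraph G" and num: "numbered G" and ne: "verts G \<noteq> {}" and n: "n = card (verts G)"
    and deg: "min_degree G \<ge> 3" and adj: "adjacency_list G A" and \<epsilon>: "0 < \<epsilon>" "\<epsilon> < 1"
  shows "\<exists>t. real t \<le> 2 * (36 + 78 * 2 ^ 84) * ((real n ^ 73 / \<epsilon> ^ 72) * ln (real n / \<epsilon>)) \<and>
    halted prog (run prog \<epsilon> t (initial_config (encode n A))) \<and>
    (\<forall>s\<le>t. fits (word_bound 13 G \<epsilon>) (run prog \<epsilon> s (initial_config (encode n A)))) \<and>
    is_approximation \<epsilon> (real (card (sink_free_orientations G)))
      (result (run prog \<epsilon> t (initial_config (encode n A))))"
proof -
  define nb where "nb = (\<lambda>v. map fst (A v))"
  define M where "M = card (edges G)"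
  interpret sink_free_graph G nb
    unfolding nb_def by (rule adjacency_list_sink_free_graph[OF wf adj deg])
  have V: "verts G = {..<n}" and E: "edges G = {..<M}" using num n by (auto simp: numbered_def M_def)
  have n0: "0 < n" using ne V by auto
  have len: "length (nb v) = length (A v)" for v by (simp add: nb_def)
  have M3: "3 \<le> M"
  proof -
    have "vdegree G 0 \<le> M" unfolding vdegree_def M_def
      using wf by (intro card_mono) (auto simp: wf_multigraph_def)
    then show ?thesis using degree3[of 0] n0 V by simp
  qed
  \<comment> \<open>An edge has two distinct ends. This keeps \<open>ln (n / \<epsilon>)\<close>
    away from 0.\<close>
  have n2: "2 \<le> n"
  proof -
    have "card (ends G 0) = 2" "ends G 0 \<subseteq> {..<n}" using wf M3 E V by (auto simp: wf_multigraph_def)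
    then show ?thesis using card_mono[of "{..<n}" "ends G 0"] by simp
  qed
  \<comment> \<open>Every edge occurs in two lists and every entry takes two cells; this is the
    summand \<open>4 * M\<close> of \<open>MB\<close>.\<close>
  have sum: "(\<Sum>u<n. length (A u)) = 2 * M"
    using handshake[OF wf] length_nb unfolding V M_def[symmetric] by (simp add: len)
  obtain L where L: "\<And>l. l < L \<Longrightarrow> \<not> real n < \<epsilon> * 2 ^ l" "real n < \<epsilon> * 2 ^ L" "2 ^ L \<le> 2 * (real n / \<epsilon>)"
    using scaling_exponent[OF \<epsilon> n0] by blast
  define S where "S = (1024::nat) * 2 ^ L"
  define b where "b = 56 + 28 * L"
  define MB where "MB = 1 + 2 * n + 4 * M"
  define st where "st = start_address n A"
  define Q where "Q = nat \<lceil>1 / \<epsilon>\<rceil>"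
  define B where "B = word_bound 13 G \<epsilon>"
  have B: "B = (n + M + Q) ^ 13" by (simp add: B_def word_bound_def n M_def Q_def)
  have Q: "1 / \<epsilon> \<le> real Q" unfolding Q_def by linarith
  have "1 < 1 / \<epsilon>" using \<epsilon> by simp
  with Q have Q2: "2 \<le> Q" by linarith
  have y: "2 ^ L \<le> 2 * n * Q"
  proof -
    have "(2::real) ^ L \<le> 2 * n * (1 / \<epsilon>)" using L(3) by simp
    also have "\<dots> \<le> 2 * n * real Q" using Q by (intro mult_left_mono) auto
    finally have "real (2 ^ L) \<le> real (2 * n * Q)" by simp
    then show ?thesis by (simp only: of_nat_le_iff)
  qed
  have sz: "2 * (S * S) \<le> B" "MB + n + 5 * b \<le> B" "10 + L + n \<le> B"
    using size_bounds[OF refl _ M3 Q2 y] n0 unfolding B S_def MB_def b_def by auto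
  have S0: "0 < S" by (simp add: S_def)
  have marg: "ratio v (verts G - R) \<le> marginal S nb k R v / S \<and>
      marginal S nb k R v / S \<le> ratio v (verts G - R) + err S k \<and> marginal S nb k R v \<le> S"
    "3/4 \<le> ratio v (verts G - R)" if "v < n" "v \<in> R" for v R k
    using marginal_error[OF S0, of v R k] ratio_ge(1)[of "verts G - R" v] that V by auto
  interpret machine nb st n S MB B \<epsilon>
  proof
    fix v assume v: "v < n"
    show "u < n" if "u \<in> set (nb v)" for u using nb_verts[of v u] v that V by auto
    show "3 \<le> length (nb v)" using degree3 length_nb v V by auto
    have "(\<Sum>u<v. length (A u)) + length (A v) = (\<Sum>u<Suc v. length (A u))" by simp
    also have "\<dots> \<le> (\<Sum>u<n. length (A u))" using v by (intro sum_mono2) auto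
    finally show "2 * n < st v \<and> st v + 2 * length (nb v) \<le> MB"
      unfolding st_def start_address_def MB_def len using sum by simp
  next
    fix u R k assume "u < n" "u \<in> (R::nat set)"
    \<comment> \<open>The approximations err upwards, so the lower bound 3/4 for exact ratios passes
      to them; the machine only needs 1/2.\<close>
    from marg(1)[OF this, of k] marg(2)[OF this] have "3/4 \<le> marginal S nb k R u / S" by linarith
    then have "3 * real S \<le> 4 * real (marginal S nb k R u)" using S0 by (simp add: field_simps)
    then show "S \<le> 2 * marginal S nb k R u" by linarith
  qed (use sz S0 in \<open>auto simp: MB_def\<close>)
  let ?m = "mem (initial_config (encode n A))"
  have init_eq: "initial_config (encode n A) = cfg 0 (\<lambda>_. 0) ?m" by (simp add: initial_config_def)
  have lenE: "length (encode n A) = MB" unfolding length_encode sum MB_def by simp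
  have m: "?m a = (if a < MB then encode n A ! a else 0)" for a by (simp add: initial_config_def lenE)
  have inp: "input_ok ?m"
    unfolding input_ok_def
  proof (intro allI impI conjI)
    fix v assume v: "v < n"
    have "2 * v + 2 < MB" using v MB by linarith
    then show "?m (2 * v + 1) = length (nb v)" "?m (2 * v + 2) = st v"
      unfolding m using encode_nth(1,2)[OF v] by (simp_all add: len st_def)
    fix j assume j: "j < length (nb v)"
    then have "st v + 2 * j < MB" using start[OF v] by linarith
    then show "?m (st v + 2 * j) = nb v ! j"
      unfolding m using encode_nth(3)[OF v, of j] j by (simp add: len st_def nb_def)
  qed
  have m0: "?m 0 = n" unfolding m by (simp add: MB_def encode_def)
  have last: "MB = st (n - 1) + 2 * length (nb (n - 1))"
  proof -
    obtain k where k: "n = Suc k" using n0 by (cases n) auto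
    then show ?thesis using sum unfolding st_def start_address_def MB_def len by simp
  qed
  have fit: "fits B (initial_config (encode n A))"
  proof -
    have lists: "length (A v) \<le> MB" "st v \<le> MB" if "v < n" for v
      using start[OF that] by (simp_all add: len)
    have entries: "u \<le> MB" "e \<le> MB" if "(u, e) \<in> set (A v)" "v < n" for u e v
    proof -
      have "set (A v) = {(u, e). e \<in> edges G \<and> ends G e = {v, u}}"
        using adj that(2) V by (auto simp: adjacency_list_def)
      then have "e \<in> edges G" "u \<in> verts G" using that(1) wf by (auto simp: wf_multigraph_def)
      then show "u \<le> MB" "e \<le> MB" unfolding V E MB_def by simp_all
    qed
    have "x \<le> MB" if "x \<in> set (encode n A)" for x
    proof -
      have "x \<in> insert n ((\<Union>v\<in>{0..<n}. {length (A v), st v}) \<union> (\<Union>v\<in>{0..<n}. \<Union>p\<in>set (A v). {fst p, snd p}))"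
        using that unfolding encode_def st_def by (simp add: case_prod_unfold)
      then show ?thesis using MB(1) by (auto simp: lists dest: entries)
    qed
    then have le: "?m a \<le> MB" for a unfolding m using lenE by simp
    have "?m a \<le> B" for a using le[of a] MB(2) by linarith
    then show ?thesis unfolding fits_def by (simp add: initial_config_def)
  qed
  have b56: "56 + 28 * L \<le> B" using sz(2) unfolding b_def by simp
  have mM: "(MB - 1 - 2 * n) div 4 = M" by (simp add: MB_def)
  let ?Q1 = "\<lambda>s. \<exists>r'. s = cfg 27 r' ?m \<and> consts_ok r' \<and> r' 0 = S \<and>
    r' 1 = (MB - 1 - 2 * n) div 4 \<and> r' 2 = 10 + L \<and> r' 7 = 56 + 28 * L \<and> r' 10 = 0"
  let ?acc = "accum S (root_value b) n"
  let ?Q2 = "\<lambda>s. \<exists>r' m'. s = cfg 97 r' m' \<and> r' 0 = fst ?acc \<and> r' 1 = M \<and> r' 2 = 10 + L + snd ?acc"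
  have 1: "reaches prog \<epsilon> B (6 * L + 22) (initial_config (encode n A)) ?Q1"
    using init[OF inp m0 n0 last S_def L(1,2) b56] unfolding init_eq[symmetric] .
  have 2: "reaches prog \<epsilon> B (n * (64 * 2 ^ b + 14) + 2) s ?Q2" if s: "?Q1 s" for s
  proof -
    obtain r where r: "s = cfg 27 r ?m" "consts_ok r" "r 0 = S" "r 1 = M" "r 2 = 10 + L" "r 7 = b" "r 10 = 0"
      using s unfolding mM b_def by blast
    have marks: "?m (MB + u) = (if u < 0 then 1 else 0)" for u unfolding m by simp
    have "reaches prog \<epsilon> B (n * (64 * 2 ^ b + 14) + 2) s (\<lambda>s. \<exists>r' m'. s = cfg 97 r' m' \<and>
      r' 0 = fst ?acc \<and> r' 1 = r 1 \<and> r' 2 = 10 + L + snd ?acc)"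
      unfolding r(1) by (rule root_loop[where i = 0]) (use r inp marks sz in auto)
    then show ?thesis unfolding r(4) .
  qed
  have "reaches prog \<epsilon> B (6 * L + 22 + (n * (64 * 2 ^ b + 14) + 2)) (initial_config (encode n A)) ?Q2"
    by (rule reaches_trans[OF 1 2])
  then obtain t where t: "t \<le> 6 * L + 22 + (n * (64 * 2 ^ b + 14) + 2)"
    "?Q2 (run prog \<epsilon> t (initial_config (encode n A)))"
    "\<forall>s\<le>t. fits B (run prog \<epsilon> s (initial_config (encode n A)))"
    using fit unfolding reaches_def by blast
  obtain r' m' where r': "run prog \<epsilon> t (initial_config (encode n A)) = cfg 97 r' m'" "r' 0 = fst ?acc" "r' 1 = M"
    "r' 2 = 10 + L + snd ?acc" using t(2) by blast
  have prod: "(\<Prod>i<n. ratio i (verts G - {..i})) = real (card (sink_free_orientations G)) / 2 ^ M"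
    using prod_ratio[of "\<lambda>i. i" n] V unfolding cnt_verts M_def by simp
  have "is_approximation \<epsilon> (real (card (sink_free_orientations G)))
    (real (fst ?acc) * 2 ^ M / 2 ^ (10 + L + snd ?acc))"
  proof (rule accuracy[OF \<epsilon> n0 L(2) S_def _ _ _ prod])
    fix i assume i: "i < n"
    show "3/4 \<le> ratio i (verts G - {..i})" by (rule marg(2)[OF i]) simp
    show "ratio i (verts G - {..i}) \<le> root_value b i / S \<and> root_value b i / S \<le> ratio i (verts G - {..i}) + err S (56 + 28 * L)"
      using marg(1)[OF i, of "{..i}" b] by (simp add: root_value_def b_def)
    show "root_value b i \<le> S \<and> S \<le> 2 * root_value b i" by (rule root_value_bounds[OF i])
  qed
  then have approx: "is_approximation \<epsilon> (real (card (sink_free_orientations G)))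
      (result (run prog \<epsilon> t (initial_config (encode n A))))"
    by (simp only: r' result_def config.simps)
  have "real t \<le> real (6 * L + 22 + (n * (64 * 2 ^ b + 14) + 2))" using t(1) by (simp only: of_nat_le_iff)
  also have "\<dots> \<le> 2 * (36 + 78 * 2 ^ 84) * ((real n ^ 73 / \<epsilon> ^ 72) * ln (real n / \<epsilon>))"
    unfolding b_def by (rule running_time[OF \<epsilon> n2 L(3)])
  finally have time: "real t \<le> 2 * (36 + 78 * 2 ^ 84) * ((real n ^ 73 / \<epsilon> ^ 72) * ln (real n / \<epsilon>))" .
  have "halted prog (run prog \<epsilon> t (initial_config (encode n A)))" unfolding r'(1) halted_def by simp
  with time t(3) approx show ?thesis unfolding B_def by blast
qed

theorem theorem1p1:
  "\<exists>(P :: instr list) (C :: real) (c :: nat).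
     \<forall>(G :: (nat, nat) multigraph) (A :: nat \<Rightarrow> (nat \<times> nat) list) (\<epsilon> :: real) (n :: nat).
       wf_multigraph G \<and> numbered G \<and> verts G \<noteq> {} \<and> n = card (verts G) \<and>
       min_degree G \<ge> 3 \<and> adjacency_list G A \<and> 0 < \<epsilon> \<and> \<epsilon> < 1 \<longrightarrow>
       (\<exists>t :: nat.
          real t \<le> C * ((real n ^ 73 / \<epsilon> ^ 72) * ln (real n / \<epsilon>)) \<and>
          halted P (run P \<epsilon> t (initial_config (encode n A))) \<and>
          (\<forall>s\<le>t. fits (word_bound c G \<epsilon>) (run P \<epsilon> s (initial_config (encode n A)))) \<and>
          is_approximation \<epsilon> (real (card (sink_free_orientations G)))
            (result (run P \<epsilon> t (initial_config (encode n A)))))"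
proof (rule exI[of _ prog], rule exI[of _ "2 * (36 + 78 * 2 ^ 84)"], rule exI[of _ 13], intro allI impI, elim conjE)
  fix G :: "(nat, nat) multigraph" and A :: "nat \<Rightarrow> (nat \<times> nat) list" and \<epsilon> :: real and n :: nat
  assume "wf_multigraph G" "numbered G" "verts G \<noteq> {}" "n = card (verts G)"
    "min_degree G \<ge> 3" "adjacency_list G A" "0 < \<epsilon>" "\<epsilon> < 1"
  then show "\<exists>t. real t \<le> 2 * (36 + 78 * 2 ^ 84) * ((real n ^ 73 / \<epsilon> ^ 72) * ln (real n / \<epsilon>)) \<and>
    halted prog (run prog \<epsilon> t (initial_config (encode n A))) \<and>
    (\<forall>s\<le>t. fits (word_bound 13 G \<epsilon>) (run prog \<epsilon> s (initial_config (encode n A)))) \<and>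
    is_approximation \<epsilon> (real (card (sink_free_orientations G)))
      (result (run prog \<epsilon> t (initial_config (encode n A))))"
    by (rule prog_correct)
qed

end
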